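(* Let $G$ be a finite abelian group and $H\subseteq G$ a subgroup. Let $E\subseteq G$ multi-tile $G$ with partner $H$ at level $\ell>1$. Suppose that, up to $H$-translation, there are $k$ distinct translated $H$-cross sections of $E$, and that these translated $H$-cross sections have a simultaneous basis in $\widehat H$. Then $$\widetilde L(E)<e\,\ell^{k\ell},\qquad \widetilde U(E)<\ell-\frac{\ell-1}{2^{k+1}\ell^k},\qquad \rho(E)<e\,\ell^{k\ell+1},\qquad \widetilde D(E)\le\sqrt{\ell}.$$
   Context: For a finite abelian group $\Gamma$ with dual $\widehat\Gamma$ (characters $\Gamma\to\mathbb{S}^1$), nonempty $E=\{x_1,\dots,x_n\}\subseteq\Gamma$ and $B=\{b_1,\dots,b_n\}\subseteq\widehat\Gamma$, $T(E,B)$ is the $n\times n$ matrix with $(i,j)$ entry $b_j(x_i)$; $(E,B)$ is a basis pair if $T(E,B)$ is invertible. $L_E(B)=\sigma_{\min}(T)^2$, $U_E(B)=\|T\|^2$ (operator $2$-norm), $\rho_E(B)=U_E(B)/L_E(B)$, $D_E(B)=|\det T|$; normalized: $\widetilde L_E(B)=n/L_E(B)$, $\widetilde U_E(B)=U_E(B)/n$, $\widetilde D_E(B)=\sqrt n/D_E(B)^{1/n}$; for sets, $\widetilde Q(E)=\min_B\widetilde Q_E(B)$ and $\rho(E)=\min_B\rho_E(B)$ over $B\subseteq\widehat G$ with $|B|=|E|$. $E$ multi-tiles $G$ with partner $H$ at level $\ell$ if $|E\cap(g+H)|=\ell$ for every coset $g+H$. For each coset $g+H$, the set $(E\cap(g+H))-g\subseteq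 H$ is a translated $H$-cross section of $E$; it is determined up to translation by an element of $H$. A set $B\subseteq\widehat H$ is a simultaneous basis for subsets $F_1,\dots,F_k\subseteq H$ of equal size if $(F_i,B)$ is a basis pair (in $H$) for every $i$. $e$ is Euler's number. *)

theory Defs
  imports
    "HOL-Library.Extended_Real"
    "HOL-Algebra.Coset"
    "Jordan_Normal_Form.Schur_Decomposition"
begin

text \<open>Groups are written multiplicatively throughout, following HOL-Algebra.\<close>

definition circle_group :: "complex monoid" where
  "circle_group = \<lparr>carrier = {z. cmod z = 1}, monoid.mult = (*), one = 1\<rparr>"

text \<open>Characters are made extensional, so that each one is represented by exactly one
  HOL function and cardinalities of sets of characters are the intended ones.\<close>

definition dual_group :: "('a, 'm) monoid_scheme \<Rightarrow> ('a \<Rightarrow> complex) set" where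
  "dual_group \<Gamma> = hom \<Gamma> circle_group \<inter> extensional (carrier \<Gamma>)"

definition enumeration :: "'a set \<Rightarrow> 'a list" where
  "enumeration S = (SOME xs. distinct xs \<and> set xs = S)"

text \<open>The matrix depends on the chosen enumerations only up to permutations of its rows and
  columns, which affect neither invertibility nor any of the quantities defined below.\<close>

definition char_mat :: "'a set \<Rightarrow> ('a \<Rightarrow> complex) set \<Rightarrow> complex mat" where
  "char_mat E B = mat (card E) (card B) (\<lambda>(i, j). (enumeration B ! j) (enumeration E ! i))"

definition basis_pair ::
  "('a, 'm) monoid_scheme \<Rightarrow> 'a set \<Rightarrow> ('a \<Rightarrow> complex) set \<Rightarrow> bool" where
  "basis_pair \<Gamma> E B \<longleftrightarrow> E \<subseteq> carrier \<Gamma> \<and> E \<noteq> {} \<and> B \<subseteq> dual_group \<Gamma> \<and> card B = card E \<and>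
     invertible_mat (char_mat E B)"

definition singular_values :: "complex mat \<Rightarrow> real set" where
  "singular_values A = {s. 0 \<le> s \<and> eigenvalue (mat_adjoint A * A) (complex_of_real (s\<^sup>2))}"

definition sigma_min :: "complex mat \<Rightarrow> real" where
  "sigma_min A = Min (singular_values A)"

definition vec_norm2 :: "complex vec \<Rightarrow> real" where
  "vec_norm2 v = sqrt (\<Sum>i<dim_vec v. (cmod (v $ i))\<^sup>2)"

definition op_norm2 :: "complex mat \<Rightarrow> real" where
  "op_norm2 A = (SUP v \<in> {v \<in> carrier_vec (dim_col A). vec_norm2 v \<le> 1}. vec_norm2 (A *\<^sub>v v))"

definition L_pair :: "'a set \<Rightarrow> ('a \<Rightarrow> complex) set \<Rightarrow> real" where
  "L_pair E B = (sigma_min (char_mat E B))\<^sup>2"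

definition U_pair :: "'a set \<Rightarrow> ('a \<Rightarrow> complex) set \<Rightarrow> real" where
  "U_pair E B = (op_norm2 (char_mat E B))\<^sup>2"

definition D_pair :: "'a set \<Rightarrow> ('a \<Rightarrow> complex) set \<Rightarrow> real" where
  "D_pair E B = cmod (det (char_mat E B))"

text \<open>The minima range over all sets of \<open>card E\<close> characters, including those for which the
  matrix is singular. For these the quotients below have denominator 0, and must count as
  \<open>\<infinity>\<close> and not as the value 0 of real division by 0. Hence the division is that of
  the extended reals, where \<open>x / 0 = \<infinity>\<close> for \<open>x > 0\<close>.\<close>

definition rho_pair :: "'a set \<Rightarrow> ('a \<Rightarrow> complex) set \<Rightarrow> ereal" where
  "rho_pair E B = ereal (U_pair E B) / ereal (L_pair E B)"

definition L_norm_pair :: "'a set \<Rightarrow> ('a \<Rightarrow> complex) set \<Rightarrow> ereal" where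
  "L_norm_pair E B = ereal (real (card E)) / ereal (L_pair E B)"

definition U_norm_pair :: "'a set \<Rightarrow> ('a \<Rightarrow> complex) set \<Rightarrow> real" where
  "U_norm_pair E B = U_pair E B / real (card E)"

definition D_norm_pair :: "'a set \<Rightarrow> ('a \<Rightarrow> complex) set \<Rightarrow> ereal" where
  "D_norm_pair E B = ereal (sqrt (real (card E))) / ereal (root (card E) (D_pair E B))"

definition min_over_chars ::
  "('a, 'm) monoid_scheme \<Rightarrow> ('a set \<Rightarrow> ('a \<Rightarrow> complex) set \<Rightarrow> 'b::linorder) \<Rightarrow> 'a set \<Rightarrow> 'b" where
  "min_over_chars \<Gamma> Q E = Min {Q E B | B. B \<subseteq> dual_group \<Gamma> \<and> card B = card E}"

definition L_norm :: "('a, 'm) monoid_scheme \<Rightarrow> 'a set \<Rightarrow> ereal" where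
  "L_norm \<Gamma> = min_over_chars \<Gamma> L_norm_pair"

definition U_norm :: "('a, 'm) monoid_scheme \<Rightarrow> 'a set \<Rightarrow> real" where
  "U_norm \<Gamma> = min_over_chars \<Gamma> U_norm_pair"

definition rho :: "('a, 'm) monoid_scheme \<Rightarrow> 'a set \<Rightarrow> ereal" where
  "rho \<Gamma> = min_over_chars \<Gamma> rho_pair"

definition D_norm :: "('a, 'm) monoid_scheme \<Rightarrow> 'a set \<Rightarrow> ereal" where
  "D_norm \<Gamma> = min_over_chars \<Gamma> D_norm_pair"

definition multi_tiles :: "('a, 'm) monoid_scheme \<Rightarrow> 'a set \<Rightarrow> 'a set \<Rightarrow> nat \<Rightarrow> bool" where
  "multi_tiles G E H l \<longleftrightarrow> (\<forall>g \<in> carrier G. card (E \<inter> (g <#\<^bsub>G\<^esub> H)) = l)"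

definition cross_sections :: "('a, 'm) monoid_scheme \<Rightarrow> 'a set \<Rightarrow> 'a set \<Rightarrow> 'a set set" where
  "cross_sections G H E = {inv\<^bsub>G\<^esub> g <#\<^bsub>G\<^esub> (E \<inter> (g <#\<^bsub>G\<^esub> H)) | g. g \<in> carrier G}"

definition translation_rel :: "('a, 'm) monoid_scheme \<Rightarrow> 'a set \<Rightarrow> ('a set \<times> 'a set) set" where
  "translation_rel G H = {(F, F'). F \<subseteq> H \<and> F' \<subseteq> H \<and> (\<exists>h \<in> H. F' = h <#\<^bsub>G\<^esub> F)}"

definition simultaneous_basis ::
  "('a, 'm) monoid_scheme \<Rightarrow> 'a set set \<Rightarrow> ('a \<Rightarrow> complex) set \<Rightarrow> bool" where
  "simultaneous_basis \<Gamma> \<F> B \<longleftrightarrow> B \<subseteq> dual_group \<Gamma> \<and> (\<forall>F \<in> \<F>. basis_pair \<Gamma> F B)"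

end

theory Submission
  imports Defs "HOL-Algebra.Multiplicative_Group"
begin

text \<open>Let \<open>C\<close> be a simultaneous basis for the cross sections. For every exponent \<open>s\<close> take all characters of
  \<open>G\<close> whose restriction to \<open>H\<close> is an \<open>s\<close>-th power of an element of \<open>C\<close>. By orthogonality of the
  characters extending a given one, the Gram matrix of the character matrix \<open>T\<close> of \<open>E\<close> is \<open>[G : H]\<close> times a
  block diagonal matrix, with one block \<open>A A\<^sup>*\<close> per cross section, where \<open>A\<close> is its character matrix.

  As functions of \<open>s\<close>, the determinants are integer combinations of powers of roots of unity, so a
  product of determinants that does not vanish for \<open>s = 1\<close> has absolute value at least 1 for some \<open>s\<close>.
  Applied to the determinant of the block diagonal matrix this gives the bound on \<open>D\<close>. Applied to the
  product over the \<open>k\<close> classes of cross sections, together with Hadamard's bound \<open>\<bar>det A\<bar>\<^sup>2 \<le> l ^ l\<close>, it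
  gives \<open>\<bar>det A\<bar>\<^sup>2 \<ge> l ^ (-(k - 1) l)\<close> for every block. As \<open>A A\<^sup>*\<close> has trace \<open>l\<^sup>2\<close>, the inequality of
  arithmetic and geometric means then confines every value \<open>q\<close> of its Rayleigh quotient, by
  \<open>\<bar>det A\<bar>\<^sup>2 \<le> q ((l\<^sup>2 - q) / (l - 1)) ^ (l - 1)\<close>.\<close>

section \<open>Determinants and singular values\<close>

lemma vec_norm2_nonneg: "0 \<le> vec_norm2 v"
  unfolding vec_norm2_def by (simp add: sum_nonneg)

lemma vec_norm2_sq: "(vec_norm2 v)\<^sup>2 = (\<Sum>i<dim_vec v. (cmod (v $ i))\<^sup>2)"
  unfolding vec_norm2_def by (simp add: sum_nonneg)

lemma cscalar_prod_self: "v \<bullet>c v = complex_of_real ((vec_norm2 v)\<^sup>2)"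
  unfolding vec_norm2_sq scalar_prod_def
  by (simp add: lessThan_atLeast0 complex_norm_square del: of_real_power)

lemma mat_adjoint_eq: "mat_adjoint A = mat (dim_col A) (dim_row A) (\<lambda>(i, j). cnj (A $$ (j, i)))"
  by (rule eq_matI) (auto simp: mat_adjoint_def mat_of_rows_index)

lemma mat_adjoint_carrier:
  fixes A :: "complex mat"
  shows "A \<in> carrier_mat m n \<Longrightarrow> mat_adjoint A \<in> carrier_mat n m"
  by (auto simp: mat_adjoint_eq)

lemma mat_adjoint_mat_adjoint: "mat_adjoint (mat_adjoint A) = (A :: complex mat)"
  by (rule eq_matI) (auto simp: mat_adjoint_eq)

lemma det_mat_adjoint:
  assumes "A \<in> carrier_mat n n"
  shows "det (mat_adjoint A) = cnj (det A)"
proof -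
  interpret comm_ring_hom cnj by unfold_locales auto
  have "mat_adjoint A = transpose_mat (map_mat cnj A)"
    using assms by (intro eq_matI) (auto simp: mat_adjoint_eq)
  then show ?thesis
    using det_transpose[of "map_mat cnj A" n] assms hom_det[of A] by simp
qed

lemma cscalar_prod_mat_adjoint:
  fixes A :: "complex mat"
  assumes "A \<in> carrier_mat m n" "v \<in> carrier_vec n" "u \<in> carrier_vec m"
  shows "(A *\<^sub>v v) \<bullet>c u = v \<bullet>c (mat_adjoint A *\<^sub>v u)"
proof -
  have "(A *\<^sub>v v) \<bullet>c u = (\<Sum>i<m. \<Sum>j<n. A $$ (i, j) * v $ j * cnj (u $ i))"
    using assms by (auto simp: scalar_prod_def sum_distrib_right lessThan_atLeast0 intro!: sum.cong)
  also have "\<dots> = (\<Sum>j<n. \<Sum>i<m. A $$ (i, j) * v $ j * cnj (u $ i))"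
    by (rule sum.swap)
  also have "\<dots> = v \<bullet>c (mat_adjoint A *\<^sub>v u)"
    using assms
    by (auto simp: scalar_prod_def sum_distrib_left lessThan_atLeast0 mat_adjoint_eq mult_ac
        intro!: sum.cong)
  finally show ?thesis .
qed

lemma vec_norm2_eq_0_iff:
  assumes "v \<in> carrier_vec n"
  shows "vec_norm2 v = 0 \<longleftrightarrow> v = 0\<^sub>v n"
proof -
  have "vec_norm2 v = 0 \<longleftrightarrow> v \<bullet>c v = 0"
    by (simp add: cscalar_prod_self)
  then show ?thesis
    using conjugate_square_eq_0_vec[OF assms] by simp
qed

text \<open>Pairing the eigenvector equation with \<open>v\<close> gives
  \<open>|A v|^2 = e |v|^2\<close>, so an eigenvalue of a Gram matrix is the squared factor by which
  \<open>A\<close> stretches its eigenvector; in particular it is real and nonnegative.\<close>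

lemma gram_eigenvalue:
  fixes A :: "complex mat"
  assumes A: "A \<in> carrier_mat m n" and ev: "eigenvalue (mat_adjoint A * A) e"
  obtains v where "v \<in> carrier_vec n" "v \<noteq> 0\<^sub>v n" "mat_adjoint A *\<^sub>v (A *\<^sub>v v) = e \<cdot>\<^sub>v v"
    "e = complex_of_real ((vec_norm2 (A *\<^sub>v v) / vec_norm2 v)\<^sup>2)"
proof -
  from ev obtain v where v: "v \<in> carrier_vec n" "v \<noteq> 0\<^sub>v n"
    and eq: "(mat_adjoint A * A) *\<^sub>v v = e \<cdot>\<^sub>v v"
    using A mat_adjoint_carrier[OF A] unfolding eigenvalue_def eigenvector_def by auto
  have eq': "mat_adjoint A *\<^sub>v (A *\<^sub>v v) = e \<cdot>\<^sub>v v"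
    using eq assoc_mult_mat_vec[OF mat_adjoint_carrier[OF A] A v(1)] by simp
  have nz: "vec_norm2 v \<noteq> 0"
    using v vec_norm2_eq_0_iff by blast
  have "complex_of_real ((vec_norm2 (A *\<^sub>v v))\<^sup>2) = (mat_adjoint A *\<^sub>v (A *\<^sub>v v)) \<bullet>c v"
    using cscalar_prod_mat_adjoint[of "mat_adjoint A" n m "A *\<^sub>v v" v] A v mat_adjoint_carrier[OF A]
    by (simp add: cscalar_prod_self[symmetric] mat_adjoint_mat_adjoint del: of_real_power)
  also have "\<dots> = e * complex_of_real ((vec_norm2 v)\<^sup>2)"
    unfolding eq' using v by (simp add: cscalar_prod_self[symmetric] del: of_real_power)
  finally have "e = complex_of_real ((vec_norm2 (A *\<^sub>v v) / vec_norm2 v)\<^sup>2)"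
    using nz by (simp add: field_simps power_divide)
  with v eq' that show thesis by blast
qed

lemma trace_mult_comm:
  fixes A :: "'a :: comm_semiring_0 mat"
  assumes "A \<in> carrier_mat n m" "B \<in> carrier_mat m n"
  shows "(\<Sum>i<n. (A * B) $$ (i, i)) = (\<Sum>i<m. (B * A) $$ (i, i))"
proof -
  have "(\<Sum>i<n. (A * B) $$ (i, i)) = (\<Sum>i<n. \<Sum>j<m. A $$ (i, j) * B $$ (j, i))"
    using assms by (auto simp: scalar_prod_def lessThan_atLeast0 intro!: sum.cong)
  also have "\<dots> = (\<Sum>j<m. \<Sum>i<n. A $$ (i, j) * B $$ (j, i))"
    by (rule sum.swap)
  also have "\<dots> = (\<Sum>i<m. (B * A) $$ (i, i))"
    using assms by (auto simp: scalar_prod_def lessThan_atLeast0 mult.commute intro!: sum.cong)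
  finally show ?thesis .
qed

section \<open>Determinant bounds from the arithmetic-geometric mean inequality\<close>

text \<open>Polya's proof: with \<open>a\<close> the mean, multiply the inequalities
  \<open>x i / a \<le> exp (x i / a - 1)\<close>; the exponents on the right add up to 0.\<close>

lemma prod_le_mean_power:
  fixes x :: "'b \<Rightarrow> real"
  assumes "finite S" "\<And>i. i \<in> S \<Longrightarrow> 0 \<le> x i"
  shows "(\<Prod>i\<in>S. x i) \<le> ((\<Sum>i\<in>S. x i) / card S) ^ card S"
proof (cases "(\<Sum>i\<in>S. x i) = 0")
  \<comment> \<open>Here division by the mean is impossible. The case includes the empty set, where
    both sides are 1.\<close>
  case True
  then have "\<forall>i\<in>S. x i = 0"
    using assms by (simp add: sum_nonneg_eq_0_iff)
  then show ?thesis
    using assms(1) by (cases "S = {}") auto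
next
  case False
  define a where "a = (\<Sum>i\<in>S. x i) / card S"
  from False have "S \<noteq> {}" by auto
  with assms(1) have "card S > 0" by (simp add: card_gt_0_iff)
  moreover have "(\<Sum>i\<in>S. x i) \<ge> 0"
    using assms(2) by (intro sum_nonneg) auto
  ultimately have a: "a > 0"
    using False unfolding a_def by simp
  have "(\<Prod>i\<in>S. x i / a) \<le> (\<Prod>i\<in>S. exp (x i / a - 1))"
  proof (rule prod_mono)
    fix i assume "i \<in> S"
    then show "0 \<le> x i / a \<and> x i / a \<le> exp (x i / a - 1)"
      using a assms(2) exp_ge_add_one_self[of "x i / a - 1"] by auto
  qed
  also have "\<dots> = exp ((\<Sum>i\<in>S. x i) / a - card S)"
    using assms(1) by (simp add: exp_sum[symmetric] sum_subtractf sum_divide_distrib)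
  also have "(\<Sum>i\<in>S. x i) / a - card S = 0"
    using False \<open>card S > 0\<close> by (simp add: a_def)
  finally have "(\<Prod>i\<in>S. x i) / a ^ card S \<le> 1"
    by (simp add: prod_dividef)
  then show ?thesis
    using a unfolding a_def[symmetric] by (simp add: divide_le_eq)
qed

text \<open>Up to conjugation-free notation, \<open>|det X|^2\<close> is the product of the
  eigenvalues of \<open>X * mat_adjoint X\<close>, and the squared Frobenius norm is their sum. A
  Schur triangularization makes both visible on one diagonal. For entries of modulus 1 this is
  Hadamard's bound \<open>n ^ n\<close>.\<close>

lemma cmod_det_sq_le_frobenius:
  assumes X: "X \<in> carrier_mat n n"
  shows "(cmod (det X))\<^sup>2 \<le> ((\<Sum>i<n. \<Sum>j<n. (cmod (X $$ (i, j)))\<^sup>2) / n) ^ n"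
proof -
  define M where "M = X * mat_adjoint X"
  have aX: "mat_adjoint X \<in> carrier_mat n n" using X by (rule mat_adjoint_carrier)
  have M: "M \<in> carrier_mat n n" unfolding M_def using X aX by simp
  obtain es where es: "char_poly M = (\<Prod>e\<leftarrow>es. [:- e, 1:])"
    using char_poly_factorized[OF M] by auto
  obtain B P Q where BPQ: "schur_decomposition M es = (B, P, Q)"
    by (cases "schur_decomposition M es") auto
  from schur_decomposition[OF M es BPQ]
  have sim: "similar_mat_wit M B P Q" and ut: "upper_triangular B" and diag: "diag_mat B = es"
    by auto
  note sim' = similar_mat_witD2[OF M sim]
  define r where "r i = cmod (B $$ (i, i))" for i
  have ev: "B $$ (i, i) = complex_of_real (r i)" if "i < n" for i
  proof -
    have "B $$ (i, i) \<in> set es"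
      using that sim' unfolding diag[symmetric] diag_mat_def by auto
    then have "poly (char_poly M) (B $$ (i, i)) = 0"
      unfolding es by (simp add: poly_prod_list prod_list_zero_iff)
    \<comment> \<open>\<open>X * mat_adjoint X\<close> is read as the Gram matrix of
      \<open>mat_adjoint X\<close>, so that its eigenvalues are known to be nonnegative
      reals.\<close>
    then have "eigenvalue (mat_adjoint (mat_adjoint X) * mat_adjoint X) (B $$ (i, i))"
      using eigenvalue_root_char_poly[OF M] by (simp add: mat_adjoint_mat_adjoint M_def)
    from gram_eigenvalue[OF aX this] obtain v where
      "B $$ (i, i) = complex_of_real ((vec_norm2 (mat_adjoint X *\<^sub>v v) / vec_norm2 v)\<^sup>2)"
      by metis
    then show ?thesis unfolding r_def by (metis norm_of_real abs_of_nonneg zero_le_power2)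
  qed
  have "(\<Sum>i<n. M $$ (i, i)) = (\<Sum>i<n. (Q * (P * B)) $$ (i, i))"
    using trace_mult_comm[of "P * B" n n Q] sim' by simp
  also have "Q * (P * B) = B"
    using sim' assoc_mult_mat[of Q n n P n B n] by simp
  also have "(\<Sum>i<n. B $$ (i, i)) = complex_of_real (\<Sum>i<n. r i)"
    by (simp add: ev)
  also have "(\<Sum>i<n. M $$ (i, i)) = complex_of_real (\<Sum>i<n. \<Sum>j<n. (cmod (X $$ (i, j)))\<^sup>2)"
    unfolding M_def using X
    by (simp add: scalar_prod_def mat_adjoint_eq lessThan_atLeast0 complex_norm_square del: of_real_power)
  finally have tr: "(\<Sum>i<n. \<Sum>j<n. (cmod (X $$ (i, j)))\<^sup>2) = (\<Sum>i<n. r i)"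
    using of_real_eq_iff by blast
  have "complex_of_real ((cmod (det X))\<^sup>2) = det M"
    unfolding M_def by (simp add: det_mult[OF X aX] det_mat_adjoint[OF X] complex_norm_square del: of_real_power)
  also have "det M = det B"
    using sim by (intro det_similar) (auto simp: similar_mat_def)
  also have "\<dots> = prod_list (diag_mat B)"
    using det_upper_triangular[OF ut] sim' by blast
  also have "\<dots> = (\<Prod>i<n. B $$ (i, i))"
    using sim' by (simp add: diag_mat_def prod.list_conv_set_nth lessThan_atLeast0)
  also have "\<dots> = complex_of_real (\<Prod>i<n. r i)"
    by (simp add: ev)
  finally have "(cmod (det X))\<^sup>2 = (\<Prod>i<n. r i)"
    using of_real_eq_iff by blast
  also have "\<dots> \<le> ((\<Sum>i<n. r i) / n) ^ n"
    using prod_le_mean_power[of "{..<n}" r] by (simp add: r_def)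
  finally show ?thesis unfolding tr .
qed

text \<open>Complete \<open>x\<close> to a basis and orthogonalize by Gram-Schmidt, which keeps the
  first vector. The result is orthogonal but not normalized; dividing each column by its norm leaves
  \<open>x\<close> in place because it has norm 1.\<close>

lemma unitary_completion:
  fixes x :: "complex vec"
  assumes x: "x \<in> carrier_vec n" and x1: "vec_norm2 x = 1"
  obtains U where "U \<in> carrier_mat n n" "mat_adjoint U * U = 1\<^sub>m n" "U * mat_adjoint U = 1\<^sub>m n"
    "col U 0 = x" "n > 0"
proof -
  interpret cof_vec_space n "TYPE(complex)" .
  have x0: "x \<noteq> 0\<^sub>v n" using x1 vec_norm2_eq_0_iff[OF x] by auto
  then have n: "n > 0" using x by (cases n) auto
  define b where "b = basis_completion x"
  define ws where "ws = gram_schmidt n b"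
  from basis_completion[OF x x0, folded b_def]
  have dist_b: "distinct b" and indep: "\<not> lin_dep (set b)" and b: "set b \<subseteq> carrier_vec n"
    and hdb: "hd b = x" and len_b: "length b = n" by auto
  from hdb len_b n obtain vs where bv: "b = x # vs" by (cases b) auto
  from gram_schmidt_result[OF b dist_b indep refl, folded ws_def]
  have ws: "set ws \<subseteq> carrier_vec n" "corthogonal ws" "length ws = n" 
    by (auto simp: len_b)
  from gram_schmidt_hd[OF x, of vs, folded bv] have hdws: "hd ws = x" unfolding ws_def .
  define U where "U = mat n n (\<lambda>(i, j). (ws ! j) $ i / complex_of_real (vec_norm2 (ws ! j)))"
  have U: "U \<in> carrier_mat n n" unfolding U_def by simp
  have wsc: "ws ! i \<in> carrier_vec n" if "i < n" for i using ws that by auto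
  have nz: "vec_norm2 (ws ! i) \<noteq> 0" if "i < n" for i
    using corthogonalD[OF ws(2), of i i] that ws(3) by (auto simp: cscalar_prod_self)
  have UU: "mat_adjoint U * U = 1\<^sub>m n"
  proof (rule eq_matI)
    fix i j assume "i < dim_row (1\<^sub>m n)" "j < dim_col (1\<^sub>m n)"
    then have ij: "i < n" "j < n" by auto
    have "(mat_adjoint U * U) $$ (i, j) = (\<Sum>k<n. cnj (U $$ (k, i)) * U $$ (k, j))"
      using U ij by (simp add: mat_adjoint_eq scalar_prod_def lessThan_atLeast0)
    also have "\<dots> = (\<Sum>k<n. (ws ! j) $ k * cnj ((ws ! i) $ k)) /
        complex_of_real (vec_norm2 (ws ! i) * vec_norm2 (ws ! j))"
      unfolding sum_divide_distrib using ij by (intro sum.cong) (auto simp: U_def)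
    also have "(\<Sum>k<n. (ws ! j) $ k * cnj ((ws ! i) $ k)) = (ws ! j) \<bullet>c (ws ! i)"
      using wsc[OF ij(1)] wsc[OF ij(2)] by (auto simp: scalar_prod_def lessThan_atLeast0 intro!: sum.cong)
    also have "(ws ! j) \<bullet>c (ws ! i) / complex_of_real (vec_norm2 (ws ! i) * vec_norm2 (ws ! j)) =
        (if i = j then 1 else 0)"
      using corthogonalD[OF ws(2), of j i] ij ws(3) nz[OF ij(1)]
      by (auto simp: cscalar_prod_self power2_eq_square)
    finally show "(mat_adjoint U * U) $$ (i, j) = 1\<^sub>m n $$ (i, j)" using ij by simp
  qed (use U in \<open>auto simp: mat_adjoint_eq\<close>)
  have "U * mat_adjoint U = 1\<^sub>m n"
    using mat_mult_left_right_inverse[OF mat_adjoint_carrier[OF U] U UU] .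
  moreover have "ws ! 0 = x"
    using hdws ws(3) n by (metis hd_conv_nth length_0_conv less_numeral_extra(3))
  then have "col U 0 = x"
    using n x x1 by (intro eq_vecI) (auto simp: U_def)
  ultimately show thesis using that U UU n by blast
qed

text \<open>The Frobenius bound is applied after rescaling along an orthonormal basis that starts with \<open>x\<close>: the
  first row then has norm 1 and the squared norms of the other rows have mean 1.\<close>

lemma cmod_det_sq_le_rayleigh:
  fixes A :: "complex mat"
  assumes A: "A \<in> carrier_mat n n" and n: "n > 1" and d: "det A \<noteq> 0"
    and x: "x \<in> carrier_vec n" "vec_norm2 x = 1"
  defines "F \<equiv> (\<Sum>i<n. \<Sum>j<n. (cmod (A $$ (i, j)))\<^sup>2)" and "q \<equiv> (vec_norm2 (mat_adjoint A *\<^sub>v x))\<^sup>2"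
  shows "0 < q" "q < F" "(cmod (det A))\<^sup>2 \<le> q * ((F - q) / (real n - 1)) ^ (n - 1)"
proof -
  obtain U where U: "U \<in> carrier_mat n n" "mat_adjoint U * U = 1\<^sub>m n" "U * mat_adjoint U = 1\<^sub>m n"
    "col U 0 = x" using unitary_completion[OF x] by metis
  have aU: "mat_adjoint U \<in> carrier_mat n n" and aA: "mat_adjoint A \<in> carrier_mat n n"
    using U(1) A by (auto intro: mat_adjoint_carrier)
  \<comment> \<open>The unitary factor changes neither \<open>|det A|\<close> nor the Frobenius
    norm, and row 0 of \<open>X\<close> is the conjugate of
    \<open>mat_adjoint A *\<^sub>v x\<close>, so its squared norm is \<open>q\<close>.\<close>
  define X where "X = mat_adjoint U * A"
  have X: "X \<in> carrier_mat n n" unfolding X_def using aU A by simp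
  have detU: "cmod (det U) = 1"
  proof -
    have "complex_of_real ((cmod (det U))\<^sup>2) = 1"
      using arg_cong[OF U(3), of det] det_mult[OF U(1) aU] det_mat_adjoint[OF U(1)]
      by (simp add: complex_norm_square del: of_real_power)
    then have "(cmod (det U))\<^sup>2 = 1" using of_real_eq_1_iff by blast
    then show ?thesis by (simp add: power2_eq_1_iff) (use norm_ge_zero[of "det U"] in linarith)
  qed
  then have detX: "cmod (det X) = cmod (det A)"
    unfolding X_def by (simp add: det_mult[OF aU A] det_mat_adjoint[OF U(1)] norm_mult)
  define p where "p i = (\<Sum>j<n. (cmod (X $$ (i, j)))\<^sup>2)" for i
  \<comment> \<open>A zero row would make the determinant vanish. Positivity of row 0 gives
    \<open>0 < q\<close>, that of the other rows gives \<open>q < F\<close>.\<close>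
  have p_pos: "p i > 0" if i: "i < n" for i
  proof (rule ccontr)
    assume "\<not> p i > 0"
    then have "p i = 0"
      unfolding p_def by (meson sum_nonneg not_less order_antisym zero_le_power2)
    then have "\<forall>j<n. X $$ (i, j) = 0"
      unfolding p_def by (simp add: sum_nonneg_eq_0_iff)
    then have "transpose_mat X *\<^sub>v unit_vec n i = 0\<^sub>v n"
      using X i by (intro eq_vecI) auto
    then have "det (transpose_mat X) = 0"
      using det_0_iff_vec_prod_zero[of "transpose_mat X" n] X i unit_vec_nonzero[of i n] unit_vec_carrier
      by (metis transpose_carrier_mat)
    then have "det X = 0" using det_transpose[OF X] by simp
    then show False using detX d by simp
  qed
  have q: "q = p 0"
  proof -
    have "(cmod ((mat_adjoint A *\<^sub>v x) $ j))\<^sup>2 = (cmod (X $$ (0, j)))\<^sup>2" if "j < n" for j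
    proof -
      have "(mat_adjoint A *\<^sub>v x) $ j = (\<Sum>i<n. cnj (A $$ (i, j)) * x $ i)"
        using A x that by (auto simp: mat_adjoint_eq scalar_prod_def lessThan_atLeast0)
      also have "\<dots> = cnj (\<Sum>i<n. cnj (U $$ (i, 0)) * A $$ (i, j))"
        using U(1) n unfolding U(4)[symmetric] by (simp add: mult.commute)
      also have "(\<Sum>i<n. cnj (U $$ (i, 0)) * A $$ (i, j)) = X $$ (0, j)"
        using U(1) A n that by (auto simp: X_def mat_adjoint_eq scalar_prod_def lessThan_atLeast0)
      finally show ?thesis by simp
    qed
    then show ?thesis using A unfolding q_def vec_norm2_sq p_def by (simp add: mat_adjoint_eq)
  qed
  have F: "F = (\<Sum>i<n. p i)"
  proof -
    have "complex_of_real F = (\<Sum>i<n. (A * mat_adjoint A) $$ (i, i))"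
      unfolding F_def using A
      by (simp add: mat_adjoint_eq scalar_prod_def lessThan_atLeast0 complex_norm_square del: of_real_power)
    also have "\<dots> = (\<Sum>i<n. (mat_adjoint A * A) $$ (i, i))"
      by (rule trace_mult_comm[OF A aA])
    also have "mat_adjoint A * A = mat_adjoint X * X"
    proof -
      have "mat_adjoint X = mat_adjoint A * U"
        using A U(1) by (intro eq_matI) (auto simp: X_def mat_adjoint_eq scalar_prod_def mult.commute)
      then have "mat_adjoint X * X = mat_adjoint A * (U * (mat_adjoint U * A))"
        using assoc_mult_mat[OF aA U(1) X] by (simp add: X_def)
      also have "U * (mat_adjoint U * A) = A"
        using assoc_mult_mat[OF U(1) aU A] U(3) A by simp
      finally show ?thesis by simp
    qed
    also have "(\<Sum>i<n. (mat_adjoint X * X) $$ (i, i)) = (\<Sum>i<n. (X * mat_adjoint X) $$ (i, i))"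
      by (rule trace_mult_comm[OF mat_adjoint_carrier[OF X] X])
    also have "\<dots> = complex_of_real (\<Sum>i<n. p i)"
      unfolding p_def using X
      by (simp add: mat_adjoint_eq scalar_prod_def lessThan_atLeast0 complex_norm_square del: of_real_power)
    finally show ?thesis using of_real_eq_iff by blast
  qed
  have split: "(\<Sum>i<n. f i) = f 0 + (\<Sum>i\<in>{1..<n}. f i)" for f :: "nat \<Rightarrow> real"
    using n by (simp add: lessThan_atLeast0 sum.atLeast_Suc_lessThan)
  have Fq: "F - q = (\<Sum>i\<in>{1..<n}. p i)"
    unfolding F q by (subst split) simp
  show q0: "0 < q" unfolding q using p_pos n by simp
  have "0 < F - q" unfolding Fq using n p_pos by (intro sum_pos) auto
  then show qF: "q < F" by simp
  define a where "a = (real n - 1) / (F - q)"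
  have a: "a > 0" unfolding a_def using qF n by simp
  define t where "t i = (if i = 0 then 1 / q else a)" for i :: nat
  have t0: "t i > 0" for i unfolding t_def using q0 a by simp
  define Y where "Y = mat_diag n (\<lambda>i. complex_of_real (sqrt (t i))) * X"
  have D: "mat_diag n (\<lambda>i. complex_of_real (sqrt (t i))) \<in> carrier_mat n n" by simp
  have Y: "Y \<in> carrier_mat n n" unfolding Y_def using D X by (rule mult_carrier_mat)
  have Yij: "(cmod (Y $$ (i, j)))\<^sup>2 = t i * (cmod (X $$ (i, j)))\<^sup>2" if "i < n" "j < n" for i j
    using that X t0[of i] unfolding Y_def
    by (simp add: mat_diag_mult_left[OF X] norm_mult power_mult_distrib)
  have "(\<Sum>i<n. \<Sum>j<n. (cmod (Y $$ (i, j)))\<^sup>2) = (\<Sum>i<n. t i * p i)"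
    unfolding p_def sum_distrib_left by (intro sum.cong) (auto simp: Yij)
  also have "\<dots> = 1 + a * (F - q)"
    unfolding split Fq sum_distrib_left using q0 by (auto simp: t_def q)
  also have "\<dots> = n" using qF by (simp add: a_def)
  finally have frob: "(\<Sum>i<n. \<Sum>j<n. (cmod (Y $$ (i, j)))\<^sup>2) = n" .
  have "det (mat_diag n (\<lambda>i. complex_of_real (sqrt (t i)))) = (\<Prod>i<n. complex_of_real (sqrt (t i)))"
  proof -
    have "upper_triangular (mat_diag n (\<lambda>i. complex_of_real (sqrt (t i))))"
      by (auto simp: mat_diag_def)
    from det_upper_triangular[OF this D] show ?thesis
      by (simp add: diag_mat_def prod.list_conv_set_nth lessThan_atLeast0 mat_diag_def)
  qed
  then have "(cmod (det Y))\<^sup>2 = (\<Prod>i<n. t i) * (cmod (det A))\<^sup>2"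
    unfolding Y_def det_mult[OF D X] norm_mult detX
    by (simp add: power_mult_distrib prod_norm[symmetric] prod_power_distrib t0 less_imp_le)
  also have "(\<Prod>i<n. t i) = 1 / q * a ^ (n - 1)"
    using n by (simp add: lessThan_atLeast0 prod.atLeast_Suc_lessThan t_def)
  finally have "1 / q * a ^ (n - 1) * (cmod (det A))\<^sup>2 \<le> 1"
    using cmod_det_sq_le_frobenius[OF Y] n unfolding frob by simp
  then show "(cmod (det A))\<^sup>2 \<le> q * ((F - q) / (real n - 1)) ^ (n - 1)"
    using q0 qF n by (simp add: a_def power_divide field_simps)
qed

section \<open>Singular values and operator norm from bounds on the adjoint\<close>

text \<open>The hypothesis concerns the adjoint, while singular values come from
  \<open>mat_adjoint T * T\<close>. If \<open>v\<close> is an eigenvector for \<open>s^2\<close>,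
  then applying the hypothesis to \<open>T v\<close> gives
  \<open>a s^2 |v|^2 \<le> s^4 |v|^2\<close>, and \<open>s\<close> is nonzero because
  \<open>T\<close> is invertible.\<close>

lemma sigma_min_sq_ge:
  fixes T :: "complex mat"
  assumes T: "T \<in> carrier_mat n n" and n: "n > 0" and a: "a > 0"
    and lower: "\<And>w. w \<in> carrier_vec n \<Longrightarrow> a * (vec_norm2 w)\<^sup>2 \<le> (vec_norm2 (mat_adjoint T *\<^sub>v w))\<^sup>2"
  shows "a \<le> (sigma_min T)\<^sup>2"
proof -
  have aT: "mat_adjoint T \<in> carrier_mat n n" using T by (rule mat_adjoint_carrier)
  have d: "det T \<noteq> 0"
  proof
    assume "det T = 0"
    then have "det (mat_adjoint T) = 0" using det_mat_adjoint[OF T] by simp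
    then obtain w where w: "w \<in> carrier_vec n" "w \<noteq> 0\<^sub>v n" "mat_adjoint T *\<^sub>v w = 0\<^sub>v n"
      using det_0_iff_vec_prod_zero[OF aT] by auto
    then have "vec_norm2 (mat_adjoint T *\<^sub>v w) = 0" "vec_norm2 w \<noteq> 0"
      using vec_norm2_eq_0_iff[of _ n] by auto
    then show False using lower[OF w(1)] a by (auto simp: mult_le_0_iff)
  qed
  let ?M = "mat_adjoint T * T"
  have M: "?M \<in> carrier_mat n n" using T aT by simp
  \<comment> \<open>Finiteness and nonemptiness of the set of singular values ensure that its
    \<open>Min\<close> is one of them.\<close>
  have fin: "finite {e. eigenvalue ?M e}"
  proof -
    have "char_poly ?M \<noteq> 0" using degree_monic_char_poly[OF M] by auto
    then show ?thesis unfolding eigenvalue_root_char_poly[OF M] by (rule poly_roots_finite)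
  qed
  have "inj_on (\<lambda>s. complex_of_real (s\<^sup>2)) (singular_values T)"
    by (rule inj_onI) (auto simp: singular_values_def power2_eq_iff_nonneg simp flip: of_real_power)
  moreover have "(\<lambda>s. complex_of_real (s\<^sup>2)) ` singular_values T \<subseteq> {e. eigenvalue ?M e}"
    by (auto simp: singular_values_def)
  ultimately have finS: "finite (singular_values T)"
    using fin by (meson finite_imageD finite_subset)
  have "degree (char_poly ?M) > 0" using degree_monic_char_poly[OF M] n by simp
  then have "\<not> constant (poly (char_poly ?M))" by (simp add: constant_degree)
  then obtain e where "eigenvalue ?M e"
    using fundamental_theorem_of_algebra eigenvalue_root_char_poly[OF M] by blast
  moreover from gram_eigenvalue[OF T this] obtain v where
    "e = complex_of_real ((vec_norm2 (T *\<^sub>v v) / vec_norm2 v)\<^sup>2)" by metis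
  ultimately have "vec_norm2 (T *\<^sub>v v) / vec_norm2 v \<in> singular_values T"
    unfolding singular_values_def by (simp add: vec_norm2_nonneg)
  then have ne: "singular_values T \<noteq> {}" by auto
  define s where "s = sigma_min T"
  have "s \<in> singular_values T"
    unfolding s_def sigma_min_def using finS ne by (rule Min_in)
  then have s: "0 \<le> s" "eigenvalue ?M (complex_of_real (s\<^sup>2))"
    by (auto simp: singular_values_def)
  from gram_eigenvalue[OF T s(2)] obtain v where v: "v \<in> carrier_vec n" "v \<noteq> 0\<^sub>v n"
    and eq: "mat_adjoint T *\<^sub>v (T *\<^sub>v v) = complex_of_real (s\<^sup>2) \<cdot>\<^sub>v v"
    and s2': "complex_of_real (s\<^sup>2) = complex_of_real ((vec_norm2 (T *\<^sub>v v) / vec_norm2 v)\<^sup>2)"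
    by metis
  have s2: "s\<^sup>2 = (vec_norm2 (T *\<^sub>v v) / vec_norm2 v)\<^sup>2"
    using s2' of_real_eq_iff by blast
  have v0: "vec_norm2 v \<noteq> 0" using v vec_norm2_eq_0_iff by blast
  have "T *\<^sub>v v \<noteq> 0\<^sub>v n" using d v det_0_iff_vec_prod_zero[OF T] by blast
  then have "vec_norm2 (T *\<^sub>v v) \<noteq> 0"
    using vec_norm2_eq_0_iff[of "T *\<^sub>v v" n] T v by simp
  with s2 v0 have s0: "s\<^sup>2 > 0" by simp
  have "a * (vec_norm2 (T *\<^sub>v v))\<^sup>2 \<le> (vec_norm2 (complex_of_real (s\<^sup>2) \<cdot>\<^sub>v v))\<^sup>2"
    using lower[of "T *\<^sub>v v"] T v unfolding eq by simp
  also have "\<dots> = (s\<^sup>2)\<^sup>2 * (vec_norm2 v)\<^sup>2"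
    unfolding vec_norm2_sq by (simp add: norm_mult power_mult_distrib sum_distrib_left norm_power)
  also have "(vec_norm2 (T *\<^sub>v v))\<^sup>2 = s\<^sup>2 * (vec_norm2 v)\<^sup>2"
    using s2 v0 by (simp add: power_divide)
  finally have "a * (s\<^sup>2 * (vec_norm2 v)\<^sup>2) \<le> s\<^sup>2 * (s\<^sup>2 * (vec_norm2 v)\<^sup>2)"
    by (simp add: power2_eq_square)
  moreover have "s\<^sup>2 * (vec_norm2 v)\<^sup>2 > 0" using s0 v0 by simp
  ultimately show ?thesis
    unfolding s_def[symmetric] using mult_le_cancel_right_pos by blast
qed

text \<open>With \<open>w = T v\<close> and \<open>u = mat_adjoint T w\<close>, the square
  \<open>|w|^2\<close> is the inner product of \<open>v\<close> and \<open>u\<close>. Weighting the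
  arithmetic-geometric mean inequality by \<open>b\<close> gives at most
  \<open>(b + |w|^2) / 2\<close>, and the second term is absorbed on the left.\<close>

lemma op_norm2_sq_le:
  fixes T :: "complex mat"
  assumes T: "T \<in> carrier_mat n n" and b: "b > 0"
    and upper: "\<And>w. w \<in> carrier_vec n \<Longrightarrow> (vec_norm2 (mat_adjoint T *\<^sub>v w))\<^sup>2 \<le> b * (vec_norm2 w)\<^sup>2"
  shows "(op_norm2 T)\<^sup>2 \<le> b"
proof -
  have aT: "mat_adjoint T \<in> carrier_mat n n" using T by (rule mat_adjoint_carrier)
  let ?S = "{v \<in> carrier_vec (dim_col T). vec_norm2 v \<le> 1}"
  have bound: "vec_norm2 (T *\<^sub>v v) \<le> sqrt b" if "v \<in> ?S" for v
  proof -
    have v: "v \<in> carrier_vec n" "vec_norm2 v \<le> 1" using that T by auto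
    define w where "w = T *\<^sub>v v"
    have w: "w \<in> carrier_vec n" unfolding w_def using T v by simp
    define u where "u = mat_adjoint T *\<^sub>v w"
    have u: "u \<in> carrier_vec n" unfolding u_def using aT w by simp
    have amgm: "cmod (v $ i) * cmod (u $ i) \<le> (b * (cmod (v $ i))\<^sup>2 + (cmod (u $ i))\<^sup>2 / b) / 2" for i
      using zero_le_power2[of "b * cmod (v $ i) - cmod (u $ i)"] b
      by (simp add: field_simps power2_eq_square)
    have "(vec_norm2 w)\<^sup>2 = cmod (w \<bullet>c w)"
      unfolding cscalar_prod_self by (simp del: of_real_power)
    also have "w \<bullet>c w = v \<bullet>c u"
      using cscalar_prod_mat_adjoint[OF T v(1) w] by (simp add: w_def u_def)
    also have "cmod \<dots> \<le> (\<Sum>i<n. cmod (v $ i) * cmod (u $ i))"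
      using v u unfolding scalar_prod_def lessThan_atLeast0
      by (intro order.trans[OF norm_sum] sum_mono) (auto simp: norm_mult)
    also have "\<dots> \<le> (\<Sum>i<n. (b * (cmod (v $ i))\<^sup>2 + (cmod (u $ i))\<^sup>2 / b) / 2)"
      by (rule sum_mono) (rule amgm)
    also have "\<dots> = (b * (vec_norm2 v)\<^sup>2 + (vec_norm2 u)\<^sup>2 / b) / 2"
      using v(1) u unfolding vec_norm2_sq
      by (simp add: sum.distrib sum_distrib_left flip: sum_divide_distrib)
    also have "\<dots> \<le> (b * 1 + (vec_norm2 w)\<^sup>2) / 2"
    proof -
      have "(vec_norm2 v)\<^sup>2 \<le> 1" using v(2) vec_norm2_nonneg by (simp add: power_le_one)
      moreover have "(vec_norm2 u)\<^sup>2 / b \<le> (vec_norm2 w)\<^sup>2"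
        using upper[OF w] b by (simp add: u_def divide_le_eq mult.commute)
      ultimately show ?thesis using b by (intro divide_right_mono add_mono mult_left_mono) auto
    qed
    finally have "(vec_norm2 w)\<^sup>2 \<le> b" by simp
    then show ?thesis unfolding w_def by (rule real_le_rsqrt)
  qed
  have mem: "0\<^sub>v n \<in> ?S"
    using T vec_norm2_eq_0_iff[of "0\<^sub>v n" n] by auto
  have "op_norm2 T \<le> sqrt b"
    unfolding op_norm2_def using mem bound by (intro cSUP_least) auto
  \<comment> \<open>Squaring the upper bound requires a nonnegative supremum; the zero vector
    provides this.\<close>
  moreover have "0 \<le> op_norm2 T"
  proof -
    have "vec_norm2 (T *\<^sub>v 0\<^sub>v n) \<le> op_norm2 T"
      unfolding op_norm2_def using mem bound by (intro cSUP_upper) (auto intro!: bdd_aboveI2)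
    then show ?thesis using vec_norm2_nonneg order.trans by blast
  qed
  ultimately show ?thesis
    using b power_mono[of "op_norm2 T" "sqrt b" 2] by simp
qed

section \<open>Cyclotomic integers under simultaneous powers\<close>

text \<open>The value at \<open>s\<close> stands for the image of the value at 1 under \<open>\<zeta> \<mapsto> \<zeta>^s\<close>; unlike in Galois theory,
  \<open>s\<close> is not required to be coprime to \<open>m\<close>.\<close>

inductive_set cyclotomic :: "nat \<Rightarrow> (nat \<Rightarrow> complex) set" for m where
  zero: "(\<lambda>s. 0) \<in> cyclotomic m"
| add_term: "f \<in> cyclotomic m \<Longrightarrow> w ^ m = 1 \<Longrightarrow> (\<lambda>s. f s + of_int c * w ^ s) \<in> cyclotomic m"

lemma cyclotomic_root: "w ^ m = 1 \<Longrightarrow> (\<lambda>s. w ^ s) \<in> cyclotomic m"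
  using cyclotomic.add_term[OF cyclotomic.zero, of w m 1] by simp

lemma cyclotomic_const: "(\<lambda>s. of_int c) \<in> cyclotomic m"
  using cyclotomic.add_term[OF cyclotomic.zero, of 1 m c] by simp

lemma cyclotomic_add:
  assumes "f \<in> cyclotomic m" "g \<in> cyclotomic m"
  shows "(\<lambda>s. f s + g s) \<in> cyclotomic m"
  using assms(2)
proof induction
  case zero
  then show ?case using assms(1) by simp
next
  case (add_term g w c)
  then show ?case using cyclotomic.add_term[of "\<lambda>s. f s + g s" m w c] by (simp add: add.assoc)
qed

lemma cyclotomic_mult_term:
  assumes "f \<in> cyclotomic m" "w ^ m = 1"
  shows "(\<lambda>s. f s * (of_int c * w ^ s)) \<in> cyclotomic m"
  using assms(1)
proof induction
  case zero
  then show ?case using cyclotomic.zero by simp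
next
  case (add_term f v b)
  then show ?case
    using cyclotomic.add_term[of "\<lambda>s. f s * (of_int c * w ^ s)" m "v * w" "b * c"] assms(2)
    by (simp add: power_mult_distrib algebra_simps)
qed

lemma cyclotomic_mult:
  assumes "f \<in> cyclotomic m" "g \<in> cyclotomic m"
  shows "(\<lambda>s. f s * g s) \<in> cyclotomic m"
  using assms(2)
proof induction
  case zero
  then show ?case using cyclotomic.zero by simp
next
  case (add_term g w c)
  then show ?case
    using cyclotomic_add[OF add_term.IH cyclotomic_mult_term[OF assms(1) add_term.hyps(2), of c]]
    by (simp add: distrib_left)
qed

lemma cyclotomic_cnj:
  assumes "f \<in> cyclotomic m"
  shows "(\<lambda>s. cnj (f s)) \<in> cyclotomic m"
  using assms
proof induction
  case zero
  then show ?case using cyclotomic.zero by simp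
next
  case (add_term f w c)
  have "cnj w ^ m = 1" using add_term.hyps(2) by (metis complex_cnj_one complex_cnj_power)
  then show ?case using cyclotomic.add_term[OF add_term.IH, of "cnj w" c] by simp
qed

lemma cyclotomic_sum:
  assumes "\<And>i. i \<in> I \<Longrightarrow> f i \<in> cyclotomic m"
  shows "(\<lambda>s. \<Sum>i\<in>I. f i s) \<in> cyclotomic m"
  using assms
  by (induction I rule: infinite_finite_induct) (auto intro: cyclotomic.zero cyclotomic_add)

lemma cyclotomic_prod:
  assumes "\<And>i. i \<in> I \<Longrightarrow> f i \<in> cyclotomic m"
  shows "(\<lambda>s. \<Prod>i\<in>I. f i s) \<in> cyclotomic m"
  using assms cyclotomic_const[of 1 m]
  by (induction I rule: infinite_finite_induct) (auto intro: cyclotomic_mult)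

lemma cyclotomic_power: "f \<in> cyclotomic m \<Longrightarrow> (\<lambda>s. f s ^ N) \<in> cyclotomic m"
  using cyclotomic_prod[of "{..<N}" "\<lambda>_. f" m] by simp

text \<open>By the Leibniz expansion the determinant is an integer polynomial in the entries, and
  the class is closed under sums and products.\<close>

lemma cyclotomic_det:
  assumes "\<And>i j. i < n \<Longrightarrow> j < n \<Longrightarrow> (\<lambda>s. f s i j) \<in> cyclotomic m"
  shows "(\<lambda>s. det (mat n n (\<lambda>(i, j). f s i j))) \<in> cyclotomic m"
proof -
  have "(\<lambda>s. \<Sum>p\<in>{p. p permutes {0..<n}}. signof p * (\<Prod>i = 0..<n. f s i (p i))) \<in> cyclotomic m"
  proof (rule cyclotomic_sum)
    fix p assume "p \<in> {p. p permutes {0..<n}}"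
    then have p: "p i < n" if "i < n" for i using that permutes_in_image[of p "{0..<n}" i] by auto
    have "(\<lambda>s. \<Prod>i = 0..<n. f s i (p i)) \<in> cyclotomic m"
      by (rule cyclotomic_prod) (auto intro!: assms p)
    from cyclotomic_mult[OF cyclotomic_const[of "sign p"] this]
    show "(\<lambda>s. signof p * (\<Prod>i = 0..<n. f s i (p i))) \<in> cyclotomic m"
      by simp
  qed
  also have "(\<lambda>s. \<Sum>p\<in>{p. p permutes {0..<n}}. signof p * (\<Prod>i = 0..<n. f s i (p i))) =
      (\<lambda>s. det (mat n n (\<lambda>(i, j). f s i j)))"
  proof
    fix s
    have "(\<Prod>i = 0..<n. mat n n (\<lambda>(i, j). f s i j) $$ (i, p i)) = (\<Prod>i = 0..<n. f s i (p i))"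
      if "p permutes {0..<n}" for p
      using that permutes_in_image[of p "{0..<n}"] by (intro prod.cong) auto
    then show "(\<Sum>p\<in>{p. p permutes {0..<n}}. signof p * (\<Prod>i = 0..<n. f s i (p i))) =
      det (mat n n (\<lambda>(i, j). f s i j))"
      by (subst det_def'[of _ n]) (auto intro!: sum.cong)
  qed
  finally show ?thesis .
qed

text \<open>The powers of an \<open>m\<close>-th root of unity \<open>w\<close> sum to 0 over a full
  period unless \<open>w = 1\<close>, when they sum to \<open>m\<close>. So \<open>z\<close> is the
  sum of the coefficients of the terms with \<open>w = 1\<close>.\<close>

lemma cyclotomic_sum_dvd:
  assumes "f \<in> cyclotomic m"
  shows "\<exists>z. (\<Sum>s = 1..m. f s) = of_nat m * of_int z"
  using assms
proof induction
  case zero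
  then show ?case by (intro exI[of _ 0]) simp
next
  case (add_term f w c)
  then obtain z where z: "(\<Sum>s = 1..m. f s) = of_nat m * of_int z" by blast
  \<comment> \<open>The range starts at 1 so that the value at \<open>s = 1\<close> is among the
    summands even for \<open>m = 1\<close>; a shift leads back to the geometric sum.\<close>
  have "(\<Sum>s = 1..m. w ^ s) = w * (\<Sum>s<m. w ^ s)"
    unfolding sum_distrib_left
    by (rule sum.reindex_bij_witness[of _ Suc "\<lambda>s. s - 1"]) (auto simp flip: power_Suc)
  also have "\<dots> = of_nat m * (if w = 1 then 1 else 0)"
    using geometric_sum[of w m] add_term.hyps(2) by (cases "w = 1") auto
  finally have w: "(\<Sum>s = 1..m. w ^ s) = of_nat m * (if w = 1 then 1 else 0)" .
  have "(\<Sum>s = 1..m. f s + of_int c * w ^ s) = (\<Sum>s = 1..m. f s) + of_int c * (\<Sum>s = 1..m. w ^ s)"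
    by (simp add: sum.distrib sum_distrib_left)
  also have "\<dots> = of_nat m * of_int (z + (if w = 1 then c else 0))"
    unfolding z w by (simp add: algebra_simps)
  finally show ?case by blast
qed

text \<open>If \<open>\<bar>f s\<bar> < 1\<close> wherever \<open>g s \<noteq> 0\<close>, then the sum of \<open>\<bar>f s ^ N * g s\<bar>\<^sup>2\<close> over all \<open>s\<close> is a nonnegative
  multiple of \<open>m\<close> that tends to 0 as \<open>N\<close> grows, so it vanishes. This replaces the argument that the
  norm of a nonzero algebraic integer is at least 1.\<close>

lemma cyclotomic_exists_ge_1:
  assumes m: "m > 0" and f: "f \<in> cyclotomic m" "f 1 \<noteq> 0" and g: "g \<in> cyclotomic m" "g 1 \<noteq> 0"
  shows "\<exists>s. 1 \<le> cmod (f s) \<and> g s \<noteq> 0"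
proof (rule ccontr)
  assume "\<not> ?thesis"
  then have small: "cmod (f s) < 1" if "g s \<noteq> 0" for s
    using that not_le by blast
  define S where "S N = (\<Sum>s = 1..m. (cmod (f s ^ N * g s))\<^sup>2)" for N
  have "(\<lambda>N. (cmod (f s ^ N * g s))\<^sup>2) \<longlonglongrightarrow> 0" for s
  proof (cases "g s = 0")
    case False
    then have "(\<lambda>N. cmod (f s) ^ N) \<longlonglongrightarrow> 0" using small[OF False] by (intro LIMSEQ_power_zero) simp
    then have "(\<lambda>N. (cmod (f s) ^ N * cmod (g s))\<^sup>2) \<longlonglongrightarrow> (0 * cmod (g s))\<^sup>2"
      by (intro tendsto_power[where n = 2] tendsto_mult tendsto_const)
    then show ?thesis by (simp add: norm_mult norm_power)
  qed simp
  then have "S \<longlonglongrightarrow> (\<Sum>s = 1..m. 0)"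
    unfolding S_def by (intro tendsto_sum)
  then have "\<forall>\<^sub>F N in sequentially. S N < m"
    using m by (intro order_tendstoD(2)[of S 0]) auto
  then obtain N where N: "S N < m"
    by (auto simp: eventually_sequentially)
  define h where "h s = f s ^ N * g s" for s
  have h: "h \<in> cyclotomic m"
    unfolding h_def using f g by (intro cyclotomic_mult cyclotomic_power)
  have "(\<lambda>s. h s * cnj (h s)) \<in> cyclotomic m"
    using h by (intro cyclotomic_mult cyclotomic_cnj)
  from cyclotomic_sum_dvd[OF this] obtain z where
    "(\<Sum>s = 1..m. h s * cnj (h s)) = of_nat m * of_int z" by blast
  then have "complex_of_real (S N) = complex_of_real (real m * of_int z)"
    unfolding S_def h_def[symmetric] by (simp add: complex_norm_square del: of_real_power)
  then have z: "S N = real m * of_int z"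
    using of_real_eq_iff by blast
  have nonneg: "S N \<ge> 0" unfolding S_def by (intro sum_nonneg) auto
  have "real m * of_int z < real m * 1" using N z by simp
  then have "z < 1" using m by (simp add: mult_less_cancel_left_pos)
  moreover have "z \<ge> 0" using nonneg z m by (simp add: zero_le_mult_iff)
  ultimately have "S N = 0" using z by simp
  then have "(cmod (f 1 ^ N * g 1))\<^sup>2 = 0"
    unfolding S_def using m by (subst (asm) sum_nonneg_eq_0_iff) auto
  then show False using f g by simp
qed

section \<open>Characters and restriction to a subgroup\<close>

lemma dual_group_iff:
  "b \<in> dual_group \<Gamma> \<longleftrightarrow> b \<in> extensional (carrier \<Gamma>) \<and> (\<forall>x\<in>carrier \<Gamma>. cmod (b x) = 1) \<and>
     (\<forall>x\<in>carrier \<Gamma>. \<forall>y\<in>carrier \<Gamma>. b (x \<otimes>\<^bsub>\<Gamma>\<^esub> y) = b x * b y)"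
  unfolding dual_group_def hom_def circle_group_def by auto

text \<open>In contrast to \<open>dual_group\<close> no extensionality is demanded, so pointwise
  powers and products of characters qualify without being restricted, and characters of a subgroup
  are handled inside \<open>G\<close>.\<close>

definition character_on :: "('a, 'm) monoid_scheme \<Rightarrow> 'a set \<Rightarrow> ('a \<Rightarrow> complex) \<Rightarrow> bool" where
  "character_on G H c \<longleftrightarrow> (\<forall>x\<in>H. cmod (c x) = 1) \<and> (\<forall>x\<in>H. \<forall>y\<in>H. c (x \<otimes>\<^bsub>G\<^esub> y) = c x * c y)"

lemma dual_group_subgroup_iff:
  "c \<in> dual_group (G\<lparr>carrier := H\<rparr>) \<longleftrightarrow> c \<in> extensional H \<and> character_on G H c"
  unfolding dual_group_iff character_on_def by auto

lemma dual_group_character_on: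
  "b \<in> dual_group G \<longleftrightarrow> b \<in> extensional (carrier G) \<and> character_on G (carrier G) b"
  unfolding dual_group_iff character_on_def by auto

lemma restrict_in_dual_group:
  assumes "group G" "character_on G (carrier G) c"
  shows "restrict c (carrier G) \<in> dual_group G"
proof -
  interpret group G by fact
  show ?thesis using assms(2) unfolding dual_group_character_on character_on_def by auto
qed

context group
begin

lemma character_on_one:
  assumes "subgroup H G" "character_on G H c"
  shows "c \<one> = 1"
proof -
  have "\<one> \<in> H" using assms(1) by (rule subgroup.one_closed)
  then have "c \<one> = c \<one> * c \<one>" "c \<one> \<noteq> 0"
    using assms(2) unfolding character_on_def by (metis one_closed r_one, force)
  then show ?thesis by simp
qed

lemma character_on_inv:
  assumes "subgroup H G" "character_on G H c" "x \<in> H"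
  shows "c (inv x) = cnj (c x)"
proof -
  have "inv x \<in> H" "x \<in> carrier G" using assms by (auto intro: subgroup.m_inv_closed subgroup.mem_carrier)
  then have "c x * c (inv x) = 1"
    using character_on_one[OF assms(1,2)] assms unfolding character_on_def by (metis r_inv)
  moreover have "c x * cnj (c x) = 1"
    using assms unfolding character_on_def by (simp add: complex_norm_square[symmetric])
  ultimately show ?thesis by (metis mult_cancel_left mult_zero_left zero_neq_one)
qed

lemma character_on_pow:
  assumes "subgroup H G" "character_on G H c" "x \<in> H"
  shows "c (x [^] (i :: nat)) = c x ^ i"
proof (induction i)
  case (Suc i)
  have "x [^] i \<in> H"
    using assms by (induction i) (auto intro: subgroup.one_closed subgroup.m_closed)
  then show ?case using Suc assms unfolding character_on_def by simp
qed (use character_on_one[OF assms(1,2)] in simp)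

end

lemma cmod_eq_1_if_power:
  assumes "cmod (z ^ n) = 1" "n > 0"
  shows "cmod z = 1"
  using assms power_eq_imp_eq_base[of "cmod z" n 1] by (simp add: norm_power)

section \<open>Extension of characters from a subgroup\<close>

locale finite_comm_group = comm_group G for G (structure) +
  assumes finite_carrier: "finite (carrier G)"
begin

text \<open>Natural exponents suffice because \<open>G\<close> is finite: \<open>g [^] i\<close> has
  the inverse \<open>g [^] ((order G - 1) * i)\<close>.\<close>

lemma subgroup_adjoin:
  assumes H: "subgroup H G" and g: "g \<in> carrier G"
  shows "subgroup {h \<otimes> g [^] i |h i :: nat. h \<in> H} G"
proof (rule subgroupI)
  let ?K = "{h \<otimes> g [^] i |h i :: nat. h \<in> H}"
  have Hc: "h \<in> carrier G" if "h \<in> H" for h using that H by (rule subgroup.mem_carrier[rotated])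
  show "?K \<subseteq> carrier G" using Hc g by auto
  show "?K \<noteq> {}" using subgroup.one_closed[OF H] by auto
  fix a assume "a \<in> ?K"
  then obtain h i where a: "a = h \<otimes> g [^] (i :: nat)" "h \<in> H" by auto
  have "g [^] i \<otimes> g [^] ((Coset.order G - 1) * i) = g [^] (i + (Coset.order G - 1) * i)"
    using g by (simp add: nat_pow_mult)
  also have "i + (Coset.order G - 1) * i = Coset.order G * i"
    using order_gt_0_iff_finite finite_carrier by (cases "Coset.order G") auto
  also have "g [^] (Coset.order G * i) = \<one>"
    using g pow_order_eq_1[OF g] by (simp add: nat_pow_pow[symmetric])
  finally have "inv (g [^] i) = g [^] ((Coset.order G - 1) * i)"
    using g by (intro inv_equality) (auto simp: m_comm)
  then have "inv a = inv h \<otimes> g [^] ((Coset.order G - 1) * i)"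
    unfolding a using a Hc g by (simp add: inv_mult)
  then show "inv a \<in> ?K" using subgroup.m_inv_closed[OF H a(2)] by blast
  fix b assume "b \<in> ?K"
  then obtain h' j where b: "b = h' \<otimes> g [^] (j :: nat)" "h' \<in> H" by auto
  have "a \<otimes> b = (h \<otimes> h') \<otimes> g [^] (i + j)"
    unfolding a b using a b Hc g by (simp add: nat_pow_mult[symmetric] m_ac)
  then show "a \<otimes> b \<in> ?K" using subgroup.m_closed[OF H a(2) b(2)] by blast
qed

text \<open>As \<open>n\<close> is the order of \<open>g\<close> modulo \<open>H\<close>, a power
  \<open>g [^] d\<close> lies in \<open>H\<close> only if \<open>n\<close> divides \<open>d\<close>.
  The only constraint on the value at \<open>g\<close> is therefore
  \<open>z ^ n = c (g [^] n)\<close>. The freedom in \<open>z\<close> serves both to extend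
  characters and to separate points.\<close>

lemma character_adjoin:
  assumes H: "subgroup H G" and c: "character_on G H c" and g: "g \<in> carrier G"
    and n: "n > 0" "g [^] n \<in> H" "\<forall>i. 0 < i \<longrightarrow> i < n \<longrightarrow> g [^] i \<notin> H" and z: "z ^ n = c (g [^] n)"
  obtains K c' where "subgroup K G" "H \<subseteq> K" "g \<in> K" "character_on G K c'" "\<And>h. h \<in> H \<Longrightarrow> c' h = c h"
    "c' g = z"
proof -
  have Hc: "h \<in> carrier G" if "h \<in> H" for h using that H by (rule subgroup.mem_carrier[rotated])
  define K where "K = {h \<otimes> g [^] i |h i :: nat. h \<in> H}"
  have K: "subgroup K G" unfolding K_def using H g by (rule subgroup_adjoin)
  have cmult: "c (x \<otimes> y) = c x * c y" if "x \<in> H" "y \<in> H" for x y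
    using c that unfolding character_on_def by blast
  have "cmod (z ^ n) = 1" using c n(2) unfolding z character_on_def by blast
  then have z1: "cmod z = 1" using n(1) by (rule cmod_eq_1_if_power)
  have pow: "c (g [^] d) = z ^ d" if d: "g [^] d \<in> H" for d :: nat
  proof -
    define q r where "q = d div n" and "r = d mod n"
    have dqr: "d = n * q + r" unfolding q_def r_def by simp
    have gq: "g [^] (n * q) = (g [^] n) [^] q" using g by (simp add: nat_pow_pow)
    have gqH: "g [^] (n * q) \<in> H"
      unfolding gq using n(2) H by (induction q) (auto intro: subgroup.one_closed subgroup.m_closed)
    have "g [^] r = inv (g [^] (n * q)) \<otimes> g [^] d"
      unfolding dqr using g by (simp add: nat_pow_mult[symmetric] m_assoc[symmetric])
    then have "g [^] r \<in> H"
      using gqH d H by (simp add: subgroup.m_closed subgroup.m_inv_closed)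
    moreover have "r < n" unfolding r_def using n(1) by simp
    ultimately have "r = 0" using n(3) by (metis not_gr_zero)
    then have "c (g [^] d) = c (g [^] n) ^ q"
      using dqr gq character_on_pow[OF H c n(2)] by simp
    also have "\<dots> = z ^ d" using z \<open>r = 0\<close> dqr by (simp add: power_mult)
    finally show ?thesis .
  qed
  have uniq': "c h * z ^ i = c h' * z ^ j"
    if "h \<in> H" "h' \<in> H" "h \<otimes> g [^] i = h' \<otimes> g [^] j" "i \<le> j" for h h' and i j :: nat
  proof -
    have "h \<otimes> g [^] i = (h' \<otimes> g [^] (j - i)) \<otimes> g [^] i"
      using that g Hc by (simp add: m_assoc nat_pow_mult)
    then have h: "h = h' \<otimes> g [^] (j - i)"
      using that g Hc by simp
    then have "g [^] (j - i) = inv h' \<otimes> h"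
      using that g Hc by (simp add: m_assoc[symmetric])
    then have "g [^] (j - i) \<in> H"
      using that H by (simp add: subgroup.m_closed subgroup.m_inv_closed)
    then have "c h = c h' * z ^ (j - i)"
      using that(2) h pow cmult by simp
    then show ?thesis using \<open>i \<le> j\<close> by (simp add: power_add[symmetric] mult.assoc)
  qed
  have uniq: "c h * z ^ i = c h' * z ^ j"
    if "h \<in> H" "h' \<in> H" "h \<otimes> g [^] i = h' \<otimes> g [^] j" for h h' and i j :: nat
    using uniq'[of h h' i j] uniq'[of h' h j i] that by (metis nat_le_linear)
  \<comment> \<open>By \<open>uniq\<close> the value does not depend on how \<open>x\<close> is
    written as a product.\<close>
  define c' where "c' x = (THE v. \<exists>h i. h \<in> H \<and> x = h \<otimes> g [^] (i :: nat) \<and> v = c h * z ^ i)" for x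
  have c': "c' (h \<otimes> g [^] i) = c h * z ^ i" if "h \<in> H" for h and i :: nat
    unfolding c'_def
  proof (rule the_equality)
    show "\<exists>h' j. h' \<in> H \<and> h \<otimes> g [^] i = h' \<otimes> g [^] (j :: nat) \<and> c h * z ^ i = c h' * z ^ j"
      using that by blast
  next
    fix v assume "\<exists>h' j. h' \<in> H \<and> h \<otimes> g [^] i = h' \<otimes> g [^] (j :: nat) \<and> v = c h' * z ^ j"
    then obtain h' and j :: nat where "h' \<in> H" "h \<otimes> g [^] i = h' \<otimes> g [^] j" "v = c h' * z ^ j" by blast
    then show "v = c h * z ^ i" using uniq[OF that] by simp
  qed
  have "character_on G K c'"
    unfolding character_on_def
  proof (intro conjI ballI)
    fix x assume "x \<in> K"
    then obtain h i where x: "x = h \<otimes> g [^] (i :: nat)" "h \<in> H" unfolding K_def by auto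
    then show "cmod (c' x) = 1"
      using c' c z1 unfolding character_on_def by (simp add: norm_mult norm_power)
    fix y assume "y \<in> K"
    then obtain h' j where y: "y = h' \<otimes> g [^] (j :: nat)" "h' \<in> H" unfolding K_def by auto
    have "x \<otimes> y = (h \<otimes> h') \<otimes> g [^] (i + j)"
      unfolding x y using x y Hc g by (simp add: nat_pow_mult[symmetric] m_ac)
    then show "c' (x \<otimes> y) = c' x * c' y"
      using x y c' cmult subgroup.m_closed[OF H x(2) y(2)] by (simp add: power_add)
  qed
  moreover have "c' h = c h" "h \<in> K" if "h \<in> H" for h
    using c'[OF that, of 0] that Hc[OF that] unfolding K_def by (auto, metis nat_pow_0 r_one)
  moreover have "c' g = z" "g \<in> K"
    using c'[of \<one> 1] subgroup.one_closed[OF H] g character_on_one[OF H c] unfolding K_def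
    by (auto, metis l_one nat_pow_eone)
  ultimately show thesis using that K by blast
qed

lemma order_relative:
  assumes H: "subgroup H G" and g: "g \<in> carrier G"
  obtains n :: nat where "n > 0" "g [^] n \<in> H" "\<forall>i. 0 < i \<longrightarrow> i < n \<longrightarrow> g [^] i \<notin> H"
proof -
  let ?P = "\<lambda>n :: nat. n > 0 \<and> g [^] n \<in> H"
  have "?P (Coset.order G)"
    using pow_order_eq_1[OF g] subgroup.one_closed[OF H] order_gt_0_iff_finite finite_carrier by simp
  from LeastI[of ?P, OF this] not_less_Least[of _ ?P] that show thesis by blast
qed

text \<open>Adjoin one element at a time, by induction on the number of elements outside
  \<open>H\<close>.\<close>

lemma character_extends:
  assumes "subgroup H G" "character_on G H c"
  obtains b where "b \<in> dual_group G" "\<And>h. h \<in> H \<Longrightarrow> b h = c h"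
proof -
  have "\<exists>b. b \<in> dual_group G \<and> (\<forall>h\<in>H. b h = c h)"
    using assms
  proof (induction "card (carrier G) - card H" arbitrary: H c rule: less_induct)
    case less
    have sub: "H \<subseteq> carrier G" using less.prems(1) by (rule subgroup.subset)
    show ?case
    proof (cases "H = carrier G")
      case True
      then show ?thesis
        using restrict_in_dual_group[OF is_group, of c] less.prems(2)
        by (intro exI[of _ "restrict c (carrier G)"]) auto
    next
      case False
      then obtain g where g: "g \<in> carrier G" "g \<notin> H" using sub by auto
      obtain n :: nat where n: "n > 0" "g [^] n \<in> H" "\<forall>i. 0 < i \<longrightarrow> i < n \<longrightarrow> g [^] i \<notin> H"
        by (rule order_relative[OF less.prems(1) g(1)])
      \<comment> \<open>An \<open>n\<close>-th root of \<open>c (g [^] n)\<close>, obtained by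
        dividing the argument by \<open>n\<close>.\<close>
      define z where "z = cis (Arg (c (g [^] n)) / n)"
      have "cmod (c (g [^] n)) = 1" using n(2) less.prems(2) unfolding character_on_def by blast
      then have "c (g [^] n) = cis (Arg (c (g [^] n)))"
        using rcis_cmod_Arg[of "c (g [^] n)"] by (simp add: rcis_def)
      then have "z ^ n = c (g [^] n)" unfolding z_def using n(1) by (simp add: DeMoivre)
      then obtain K c' where K: "subgroup K G" "H \<subseteq> K" "g \<in> K" "character_on G K c'"
        and ext: "\<And>h. h \<in> H \<Longrightarrow> c' h = c h"
        using character_adjoin[OF less.prems g(1) n] by metis
      have "K \<subseteq> carrier G" using K(1) by (rule subgroup.subset)
      moreover have "H \<subset> K" using K(2,3) g(2) by blast
      ultimately have "card H < card K" "card K \<le> card (carrier G)"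
        using finite_carrier by (auto intro: psubset_card_mono card_mono finite_subset)
      then obtain b where "b \<in> dual_group G" "\<forall>h\<in>K. b h = c' h"
        using less.hyps[OF _ K(1,4)] by (meson diff_less_mono2 less_le_trans)
      then show ?thesis using ext K(2) by (intro exI[of _ b]) auto
    qed
  qed
  then show thesis using that by blast
qed

text \<open>The order \<open>n\<close> of \<open>x\<close> modulo \<open>H\<close> exceeds 1, so the
  trivial character of \<open>H\<close> extends to the group generated by \<open>H\<close> and
  \<open>x\<close> with a primitive \<open>n\<close>-th root of unity as its value at
  \<open>x\<close>.\<close>

lemma character_separates:
  assumes H: "subgroup H G" and x: "x \<in> carrier G" "x \<notin> H"
  obtains b where "b \<in> dual_group G" "\<And>h. h \<in> H \<Longrightarrow> b h = 1" "b x \<noteq> 1"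
proof -
  obtain n :: nat where n: "n > 0" "x [^] n \<in> H" "\<forall>i. 0 < i \<longrightarrow> i < n \<longrightarrow> x [^] i \<notin> H"
    by (rule order_relative[OF H x(1)])
  have "n \<noteq> 1" using n(2) x by auto
  then have n2: "n > 1" using n(1) by simp
  have c: "character_on G H (\<lambda>_. 1)" unfolding character_on_def by simp
  define z where "z = cis (2 * pi / n)"
  have "z ^ n = 1" unfolding z_def using n(1) by (simp add: DeMoivre)
  then obtain K c' where K: "subgroup K G" "H \<subseteq> K" "x \<in> K" "character_on G K c'"
    and ext: "\<And>h. h \<in> H \<Longrightarrow> c' h = 1" and c'x: "c' x = z"
    using character_adjoin[OF H c x(1) n] by metis
  have "z \<noteq> 1"
  proof
    assume "z = 1"
    then have "cos (2 * pi / n) = 1" unfolding z_def by (metis cis.simps(1) one_complex.simps(1))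
    moreover have "cos (2 * pi / n) < cos 0"
      using n2 by (intro cos_monotone_0_pi) (auto simp: divide_le_eq)
    ultimately show False by simp
  qed
  moreover obtain b where "b \<in> dual_group G" "\<And>h. h \<in> K \<Longrightarrow> b h = c' h"
    using character_extends[OF K(1,4)] by metis
  ultimately show thesis using that[of b] K ext c'x by (metis subsetD)
qed

text \<open>Every value is a root of unity of order dividing the group order, and extensionality
  fixes the values off the carrier.\<close>

lemma finite_dual_group: "finite (dual_group G)"
proof (rule finite_subset)
  show "dual_group G \<subseteq> (carrier G \<rightarrow>\<^sub>E {z. z ^ Coset.order G = 1})"
  proof
    fix b assume b: "b \<in> dual_group G"
    then have ch: "character_on G (carrier G) b" by (simp add: dual_group_character_on)
    have "b x ^ Coset.order G = 1" if "x \<in> carrier G" for x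
      using character_on_pow[OF subgroup_self ch that, of "Coset.order G"] pow_order_eq_1[OF that]
        character_on_one[OF subgroup_self ch] by simp
    then show "b \<in> (carrier G \<rightarrow>\<^sub>E {z. z ^ Coset.order G = 1})"
      using b unfolding dual_group_iff PiE_def by auto
  qed
  show "finite (carrier G \<rightarrow>\<^sub>E {z :: complex. z ^ Coset.order G = 1})"
    using finite_carrier order_gt_0_iff_finite
    by (intro finite_PiE finite_roots_unity) (auto simp: Suc_le_eq)
qed

section \<open>Fibres of the restriction map and orthogonality\<close>

definition extensions :: "'a set \<Rightarrow> ('a \<Rightarrow> complex) \<Rightarrow> ('a \<Rightarrow> complex) set" where
  "extensions H c = {b \<in> dual_group G. \<forall>h\<in>H. b h = c h}"

lemma finite_extensions: "finite (extensions H c)"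
  unfolding extensions_def using finite_dual_group by simp

text \<open>The inverse map is multiplication by the conjugate of \<chi>. A \<chi> that extends
  \<open>c\<close> compares the fibre over \<open>c\<close> with the trivial one; a \<chi> that is
  trivial on \<open>H\<close> permutes each fibre.\<close>

lemma bij_betw_extensions:
  assumes H: "H \<subseteq> carrier G" and chi: "\<chi> \<in> dual_group G"
  shows "bij_betw (\<lambda>b. restrict (\<lambda>x. \<chi> x * b x) (carrier G))
    (extensions H c) (extensions H (\<lambda>x. \<chi> x * c x))"
proof -
  have chi1: "\<chi> x * cnj (\<chi> x) = 1" "cnj (\<chi> x) * \<chi> x = 1" if "x \<in> carrier G" for x
    using chi that unfolding dual_group_iff by (auto simp: complex_norm_square[symmetric] mult.commute)
  have mem: "restrict (\<lambda>x. f x * b x) (carrier G) \<in> dual_group G"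
    if "character_on G (carrier G) f" "b \<in> dual_group G" for f b
    using that unfolding dual_group_character_on character_on_def by (auto simp: norm_mult)
  have ch: "character_on G (carrier G) \<chi>" "character_on G (carrier G) (\<lambda>x. cnj (\<chi> x))"
    using chi unfolding dual_group_character_on character_on_def by auto
  show ?thesis
  proof (rule bij_betw_byWitness[where f' = "\<lambda>b. restrict (\<lambda>x. cnj (\<chi> x) * b x) (carrier G)"])
    show "\<forall>b\<in>extensions H c. restrict (\<lambda>x. cnj (\<chi> x) * (restrict (\<lambda>x. \<chi> x * b x) (carrier G)) x) (carrier G) = b"
    proof
      fix b assume "b \<in> extensions H c"
      then have "b \<in> extensional (carrier G)" unfolding extensions_def dual_group_iff by simp
      then show "restrict (\<lambda>x. cnj (\<chi> x) * (restrict (\<lambda>x. \<chi> x * b x) (carrier G)) x) (carrier G) = b"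
        by (intro extensionalityI[where A = "carrier G"]) (auto simp: chi1 mult.assoc[symmetric])
    qed
    show "\<forall>b\<in>extensions H (\<lambda>x. \<chi> x * c x). restrict (\<lambda>x. \<chi> x * (restrict (\<lambda>x. cnj (\<chi> x) * b x) (carrier G)) x) (carrier G) = b"
    proof
      fix b assume "b \<in> extensions H (\<lambda>x. \<chi> x * c x)"
      then have "b \<in> extensional (carrier G)" unfolding extensions_def dual_group_iff by simp
      then show "restrict (\<lambda>x. \<chi> x * (restrict (\<lambda>x. cnj (\<chi> x) * b x) (carrier G)) x) (carrier G) = b"
        by (intro extensionalityI[where A = "carrier G"]) (auto simp: chi1 mult.assoc[symmetric])
    qed
    show "(\<lambda>b. restrict (\<lambda>x. \<chi> x * b x) (carrier G)) ` extensions H c \<subseteq> extensions H (\<lambda>x. \<chi> x * c x)"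
      using mem[OF ch(1)] H unfolding extensions_def by auto
    show "(\<lambda>b. restrict (\<lambda>x. cnj (\<chi> x) * b x) (carrier G)) ` extensions H (\<lambda>x. \<chi> x * c x) \<subseteq> extensions H c"
      using mem[OF ch(2)] H unfolding extensions_def by (auto simp: chi1 mult.assoc[symmetric])
  qed
qed

text \<open>Translating the summation variable by some \<open>y\<close> with
  \<open>b y \<noteq> 1\<close> multiplies the sum by \<open>b y\<close>.\<close>

lemma sum_character:
  assumes b: "b \<in> dual_group G"
  shows "(\<Sum>x\<in>carrier G. b x) = (if b = restrict (\<lambda>_. 1) (carrier G) then of_nat (Coset.order G) else 0)"
proof (cases "b = restrict (\<lambda>_. 1) (carrier G)")
  case True
  then show ?thesis by (simp add: Coset.order_def)
next
  case False
  have "b \<in> extensional (carrier G)" using b unfolding dual_group_iff by simp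
  then obtain y where y: "y \<in> carrier G" "b y \<noteq> 1"
    using False extensionalityI[of b "carrier G" "restrict (\<lambda>_. 1) (carrier G)"] by fastforce
  have "(\<Sum>x\<in>carrier G. b x) = (\<Sum>x\<in>carrier G. b (y \<otimes> x))"
    using y(1) by (intro sum.reindex_bij_witness[of _ "\<lambda>x. y \<otimes> x" "\<lambda>x. inv y \<otimes> x"])
      (auto simp: m_assoc[symmetric])
  also have "\<dots> = b y * (\<Sum>x\<in>carrier G. b x)"
    using b y(1) unfolding dual_group_iff by (simp add: sum_distrib_left)
  finally show ?thesis using y(2) False by simp
qed

text \<open>For \<open>x\<close> outside \<open>H\<close>, a character trivial on \<open>H\<close>
  but not at \<open>x\<close> permutes the fibre and multiplies the sum by its value at
  \<open>x\<close>, so the sum is 0. For \<open>x\<close> in \<open>H\<close> all summands equal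
  \<open>c x\<close>, and what remains is to count them.\<close>

lemma sum_extensions:
  assumes H: "subgroup H G" and c: "character_on G H c" and d: "Coset.order G = d * card H"
    and x: "x \<in> carrier G"
  shows "(\<Sum>b\<in>extensions H c. b x) = (if x \<in> H then of_nat d * c x else 0)"
proof -
  have sub: "H \<subseteq> carrier G" using H by (rule subgroup.subset)
  have zero: "(\<Sum>b\<in>extensions H c. b x) = 0" if x: "x \<in> carrier G" "x \<notin> H" for x c
  proof -
    obtain \<chi> where chi: "\<chi> \<in> dual_group G" "\<And>h. h \<in> H \<Longrightarrow> \<chi> h = 1" "\<chi> x \<noteq> 1"
      using character_separates[OF H x] by metis
    have eq: "extensions H (\<lambda>x. \<chi> x * c x) = extensions H c"
      unfolding extensions_def using chi(2) by auto
    have "(\<Sum>b\<in>extensions H c. b x) = (\<Sum>b\<in>extensions H c. (restrict (\<lambda>x. \<chi> x * b x) (carrier G)) x)"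
      using sum.reindex_bij_betw[OF bij_betw_extensions[OF sub chi(1), of c, unfolded eq], of "\<lambda>b. b x"]
      by simp
    also have "\<dots> = \<chi> x * (\<Sum>b\<in>extensions H c. b x)"
      using x by (simp add: sum_distrib_left)
    finally show ?thesis using chi(3) by simp
  qed
  have triv: "restrict (\<lambda>_. 1) (carrier G) \<in> extensions H (\<lambda>_. 1)"
    using sub restrict_in_dual_group[OF is_group, of "\<lambda>_. 1"]
    unfolding extensions_def character_on_def by auto
  obtain \<chi> where chi: "\<chi> \<in> dual_group G" "\<And>h. h \<in> H \<Longrightarrow> \<chi> h = c h"
    using character_extends[OF H c] by metis
  have "extensions H (\<lambda>x. \<chi> x * 1) = extensions H c"
    unfolding extensions_def using chi(2) by auto
  then have card: "card (extensions H c) = card (extensions H (\<lambda>_. 1))"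
    using bij_betw_same_card[OF bij_betw_extensions[OF sub chi(1), of "\<lambda>_. 1"]] by simp
  \<comment> \<open>Double counting of the sum of \<open>b x\<close> over the extensions
    \<open>b\<close> of the trivial character and all \<open>x\<close>: orthogonality leaves the
    order of \<open>G\<close>, while vanishing off \<open>H\<close> leaves the size of the fibre
    times \<open>card H\<close>.\<close>
  have "complex_of_nat (Coset.order G) =
      (\<Sum>b\<in>extensions H (\<lambda>_. 1). if b = restrict (\<lambda>_. 1) (carrier G) then of_nat (Coset.order G) else 0)"
    using triv by (subst sum.delta) (auto simp: finite_extensions)
  also have "\<dots> = (\<Sum>b\<in>extensions H (\<lambda>_. 1). \<Sum>x\<in>carrier G. b x)"
    by (intro sum.cong refl sum_character[symmetric]) (simp add: extensions_def)
  also have "\<dots> = (\<Sum>x\<in>carrier G. \<Sum>b\<in>extensions H (\<lambda>_. 1). b x)"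
    by (rule sum.swap)
  also have "\<dots> = (\<Sum>x\<in>H. \<Sum>b\<in>extensions H (\<lambda>_. 1). b x)"
    using sub finite_carrier zero by (intro sum.mono_neutral_right) auto
  also have "\<dots> = (\<Sum>x\<in>H. of_nat (card (extensions H (\<lambda>_. 1))))"
    by (intro sum.cong refl) (simp add: extensions_def)
  also have "\<dots> = of_nat (card (extensions H (\<lambda>_. 1)) * card H)" by simp
  finally have "Coset.order G = card (extensions H (\<lambda>_. 1)) * card H" using of_nat_eq_iff by blast
  moreover have "card H > 0"
    using sub finite_carrier subgroup.one_closed[OF H] by (auto simp: card_gt_0_iff intro: finite_subset)
  ultimately have "card (extensions H c) = d" using card d by simp
  then have "(\<Sum>b\<in>extensions H c. b x) = of_nat d * c x" if "x \<in> H"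
    using that by (simp add: extensions_def)
  then show ?thesis using zero[OF x] by auto
qed

text \<open>Evaluate \<open>sum_extensions\<close> at the identity, where every character is
  1.\<close>

lemma card_extensions:
  assumes H: "subgroup H G" and c: "character_on G H c" and d: "Coset.order G = d * card H"
  shows "card (extensions H c) = d"
proof -
  have "(\<Sum>b\<in>extensions H c. b \<one>) = (\<Sum>b\<in>extensions H c. 1)"
    using character_on_one[OF subgroup_self]
    by (intro sum.cong refl) (simp add: extensions_def dual_group_character_on)
  then have "complex_of_nat (card (extensions H c)) = (\<Sum>b\<in>extensions H c. b \<one>)" by simp
  also have "\<dots> = of_nat d"
    using sum_extensions[OF assms, of \<one>] subgroup.one_closed[OF H] character_on_one[OF H c] by simp
  finally show ?thesis using of_nat_eq_iff by blast
qed

end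

section \<open>Numerical estimates\<close>

lemma one_plus_inverse_power_less_exp:
  assumes "n > 0"
  shows "(1 + 1 / real n) ^ n < exp 1"
proof -
  have "1 + 1 / real n = exp (ln (1 + 1 / real n))"
    using assms by (simp add: add_pos_pos)
  also have "\<dots> < exp (1 / real n)"
    using ln_add_one_self_less_self[of "1 / real n"] assms by simp
  finally have "(1 + 1 / real n) ^ n < exp (1 / real n) ^ n"
    using assms by (intro power_strict_mono) auto
  also have "\<dots> = exp 1" using assms by (simp add: exp_of_nat_mult[symmetric])
  finally show ?thesis .
qed

text \<open>Replacing \<open>L - q\<close> by \<open>L\<close> makes the inequality linear in
  \<open>q\<close>, which is precise enough for the lower bound.\<close>

lemma rayleigh_lower:
  fixes q L \<delta> :: real
  assumes "0 < q" "q < L" "\<delta> \<le> q * ((L - q) / r) ^ n" "r > 0"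
  shows "\<delta> * (r / L) ^ n \<le> q"
proof -
  have "\<delta> \<le> q * ((L - q) / r) ^ n" by fact
  also have "\<dots> \<le> q * (L / r) ^ n"
    using assms by (intro mult_left_mono power_mono divide_right_mono) auto
  finally have "\<delta> * (r / L) ^ n \<le> q * (L / r) ^ n * (r / L) ^ n"
    using assms by (intro mult_right_mono) auto
  also have "\<dots> = q"
    using assms by (simp add: mult.assoc power_mult_distrib[symmetric])
  finally show ?thesis .
qed

text \<open>The denominator on the left is the lower bound for the Rayleigh quotients. With
  \<open>n = l - 1\<close>, the identity \<open>(l^2 / n) ^ n = l ^ n * (1 + 1 / n) ^ n\<close>
  produces the factor \<open>e\<close>.\<close>

lemma lower_constant:
  fixes l k :: nat
  assumes l: "l > 1" and k: "k \<ge> 1"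
  shows "real l / (1 / real l ^ ((k - 1) * l) * ((real l - 1) / (real l)\<^sup>2) ^ (l - 1)) <
    exp 1 * real l ^ (k * l)"
proof -
  obtain n where n: "l = Suc n" "n > 0" using l by (cases l) auto
  obtain i where i: "k = Suc i" using k by (cases k) auto
  have "real l / (1 / real l ^ ((k - 1) * l) * ((real l - 1) / (real l)\<^sup>2) ^ (l - 1)) =
      real l ^ (i * l) * (real l * ((real l)\<^sup>2 / real n) ^ n)"
    using n i by (simp add: power_divide)
  also have "((real l)\<^sup>2 / real n) ^ n = real l ^ n * (1 + 1 / real n) ^ n"
    using n by (simp add: power_mult_distrib[symmetric] field_simps power2_eq_square)
  also have "real l ^ (i * l) * (real l * (real l ^ n * (1 + 1 / real n) ^ n)) =
      real l ^ (k * l) * (1 + 1 / real n) ^ n"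
    unfolding i by (simp add: n(1) power_add mult_ac)
  also have "\<dots> < real l ^ (k * l) * exp 1"
    using one_plus_inverse_power_less_exp[OF n(2)] l by (intro mult_strict_left_mono) auto
  finally show ?thesis by (simp add: mult.commute)
qed

text \<open>Let \<open>\<beta>\<^sub>0\<close> be the strict upper bound for \<open>\<beta>\<close>. The crude bound \<open>q < l\<^sup>2\<close> already gives \<open>q < \<beta>\<^sub>0\<close>; inserting that once more gives a bound that
  is uniformly below \<open>\<beta>\<^sub>0\<close>, as needed to keep the inequality strict for a supremum.\<close>

lemma rayleigh_upper:
  fixes l k :: nat
  assumes l: "l > 1" and k: "k \<ge> 1"
  obtains \<beta> :: real where "0 < \<beta>" "\<beta> < (real l)\<^sup>2 - (real l - 1) / (2 ^ (k + 1) * real l ^ (k - 1))"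
    "\<forall>q. 0 < q \<longrightarrow> q < (real l)\<^sup>2 \<longrightarrow>
       1 / real l ^ ((k - 1) * l) \<le> q * (((real l)\<^sup>2 - q) / (real l - 1)) ^ (l - 1) \<longrightarrow> q \<le> \<beta>"
proof -
  define \<delta> where "\<delta> = 1 / real l ^ ((k - 1) * l)"
  \<comment> \<open>In terms of \<open>y = (l^2 - q) / (l - 1)\<close>, the bound on
    \<open>q\<close> to be shown says that \<open>y\<close> exceeds \<open>u\<close>.\<close>
  define u where "u = 1 / (2 ^ (k + 1) * real l ^ (k - 1))"
  define \<beta>\<^sub>0 where "\<beta>\<^sub>0 = (real l)\<^sup>2 - (real l - 1) * u"
  obtain n where n: "l = Suc n" "n > 0" using l by (cases l) auto
  obtain i where i: "k = Suc i" using k by (cases k) auto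
  have \<delta>: "\<delta> > 0" unfolding \<delta>_def using l by simp
  have u: "u > 0" unfolding u_def using l by simp
  have u1: "u \<le> 1"
    unfolding u_def using l mult_mono[of 1 "2 ^ (k + 1)" 1 "real l ^ (k - 1)"]
      one_le_power[of "2 :: real" "k + 1"] by simp
  have "(real l - 1) * u \<le> (real l - 1) * 1" using u1 l by (intro mult_left_mono) auto
  also have "\<dots> < real l" by simp
  also have "\<dots> \<le> real l * real l" using l mult_left_mono[of 1 "real l" "real l"] by simp
  finally have \<beta>\<^sub>0: "0 < \<beta>\<^sub>0" unfolding \<beta>\<^sub>0_def by (simp add: power2_eq_square)
  have \<beta>\<^sub>0_less: "\<beta>\<^sub>0 < (real l)\<^sup>2" unfolding \<beta>\<^sub>0_def using u l by simp
  \<comment> \<open>After clearing denominators this is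
    \<open>l ^ (k + 1) \<le> (2 ^ (l - 1)) ^ (k + 1)\<close>; the factor \<open>2 ^ (k + 1)\<close>
    in \<open>u\<close> comes from here.\<close>
  have key: "(real l)\<^sup>2 * u ^ n \<le> \<delta>"
  proof -
    have "l \<le> 2 ^ n" unfolding n(1) by (simp add: Suc_le_eq)
    then have "real l \<le> 2 ^ n" by (metis of_nat_le_iff of_nat_numeral of_nat_power)
    then have "real l ^ (k + 1) \<le> (2 ^ n) ^ (k + 1)" by (intro power_mono) auto
    then have "real l ^ (i * n) * real l ^ (k + 1) \<le> real l ^ (i * n) * (2 ^ n) ^ (k + 1)"
      by (intro mult_left_mono) auto
    moreover have "(2 ^ n) ^ (k + 1) = (2 ^ (k + 1) :: real) ^ n"
      by (simp only: power_mult[symmetric] mult.commute)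
    moreover have "real l ^ (i * n) * real l ^ (k + 1) = (real l)\<^sup>2 * real l ^ (i * l)"
      unfolding power_add[symmetric] by (simp add: i n(1) add.commute)
    ultimately have "(real l)\<^sup>2 * real l ^ (i * l) \<le> (2 ^ (k + 1) * real l ^ i) ^ n"
      by (simp only: power_mult_distrib power_mult[symmetric] mult.commute)
    then show ?thesis
      unfolding \<delta>_def u_def i using l n(1) by (simp add: power_one_over field_simps)
  qed
  \<comment> \<open>The solution of \<open>\<beta>\<^sub>0 * y ^ n = \<delta>\<close>. It lies
    strictly above \<open>u\<close> because \<open>\<beta>\<^sub>0 < l^2\<close>.\<close>
  define y\<^sub>0 where "y\<^sub>0 = root n (\<delta> / \<beta>\<^sub>0)"
  have y\<^sub>0: "y\<^sub>0 ^ n = \<delta> / \<beta>\<^sub>0" "y\<^sub>0 \<ge> 0" unfolding y\<^sub>0_def using n \<delta> \<beta>\<^sub>0 by simp_all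
  have "\<beta>\<^sub>0 * u ^ n < \<delta>"
    using key mult_strict_right_mono[OF \<beta>\<^sub>0_less, of "u ^ n"] zero_less_power[OF u, of n] by linarith
  then have "u ^ n < y\<^sub>0 ^ n" unfolding y\<^sub>0 using \<beta>\<^sub>0 by (simp add: field_simps)
  then have uy: "u < y\<^sub>0" using y\<^sub>0(2) power_less_imp_less_base by blast
  \<comment> \<open>The maximum with \<open>\<beta>\<^sub>0 / 2\<close> keeps \<beta>
    positive.\<close>
  define \<beta> where "\<beta> = max (\<beta>\<^sub>0 / 2) ((real l)\<^sup>2 - (real l - 1) * y\<^sub>0)"
  have "0 < \<beta>" unfolding \<beta>_def using \<beta>\<^sub>0 by simp
  moreover have "\<beta> < \<beta>\<^sub>0" unfolding \<beta>_def using \<beta>\<^sub>0 uy l by (simp add: \<beta>\<^sub>0_def mult.commute)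
  moreover have "q \<le> \<beta>" if q: "0 < q" "q < (real l)\<^sup>2"
    "\<delta> \<le> q * (((real l)\<^sup>2 - q) / (real l - 1)) ^ n" for q
  proof -
    define y where "y = ((real l)\<^sup>2 - q) / (real l - 1)"
    have y: "y > 0" "q = (real l)\<^sup>2 - (real l - 1) * y" unfolding y_def using q l by auto
    have "(real l)\<^sup>2 * u ^ n \<le> q * y ^ n" using key q(3) unfolding y_def by simp
    also have "\<dots> < (real l)\<^sup>2 * y ^ n" using q(2) y(1) by simp
    finally have "u ^ n < y ^ n" using l by simp
    then have "u < y" using y(1) power_less_imp_less_base by (metis less_imp_le)
    then have "q \<le> \<beta>\<^sub>0" unfolding y(2) \<beta>\<^sub>0_def using l by simp
    then have "q * y ^ n \<le> \<beta>\<^sub>0 * y ^ n" using y(1) by (intro mult_right_mono) auto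
    then have "\<delta> \<le> \<beta>\<^sub>0 * y ^ n" using q(3) unfolding y_def by simp
    then have "y\<^sub>0 ^ n \<le> y ^ n" unfolding y\<^sub>0 using \<beta>\<^sub>0 by (simp add: field_simps)
    then have "y\<^sub>0 \<le> y" using y(1) n(2) power_mono_iff[of y\<^sub>0 y n] y\<^sub>0(2) by simp
    then have "q \<le> (real l)\<^sup>2 - (real l - 1) * y\<^sub>0" unfolding y(2) using l by simp
    then show ?thesis unfolding \<beta>_def by simp
  qed
  ultimately show thesis
    using that[of \<beta>] unfolding \<beta>\<^sub>0_def u_def \<delta>_def using n(1) by simp
qed

section \<open>The block structure of the character matrix\<close>

lemma enumeration:
  assumes "finite S"
  shows "distinct (enumeration S)" "set (enumeration S) = S" "length (enumeration S) = card S"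
proof -
  have "\<exists>xs. distinct xs \<and> set xs = S" using finite_distinct_list[OF assms] by auto
  from someI_ex[OF this] show "distinct (enumeration S)" "set (enumeration S) = S"
    unfolding enumeration_def by auto
  then show "length (enumeration S) = card S" using distinct_card by metis
qed

lemma bij_betw_enumeration:
  assumes "finite S"
  shows "bij_betw ((!) (enumeration S)) {..<card S} S"
  using bij_betw_nth[OF enumeration(1)[OF assms]] enumeration[OF assms] by simp

lemma sum_enumeration:
  assumes "finite S"
  shows "(\<Sum>i<card S. f (enumeration S ! i)) = (\<Sum>x\<in>S. f x)"
  by (rule sum.reindex_bij_betw[OF bij_betw_enumeration[OF assms]])

section \<open>Transversals and Parseval's identity on a fibre\<close>

context finite_comm_group
begin

text \<open>The predicate in the choice of \<open>rep x\<close> depends on \<open>x\<close> through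
  its coset alone, so elements of one coset receive the same representative.\<close>

lemma exists_transversal:
  assumes H: "subgroup H G"
  obtains R where "R \<subseteq> carrier G" "\<forall>x\<in>carrier G. \<exists>g\<in>R. inv g \<otimes> x \<in> H"
    "\<forall>g\<in>R. \<forall>g'\<in>R. inv g \<otimes> g' \<in> H \<longrightarrow> g = g'"
proof -
  have sub: "H \<subseteq> carrier G" using H by (rule subgroup.subset)
  have sym: "inv y \<otimes> x \<in> H" if "inv x \<otimes> y \<in> H" "x \<in> carrier G" "y \<in> carrier G" for x y
    using subgroup.m_inv_closed[OF H that(1)] that by (simp add: inv_mult_group)
  have trans: "inv x \<otimes> z \<in> H"
    if "inv x \<otimes> y \<in> H" "inv y \<otimes> z \<in> H" "x \<in> carrier G" "y \<in> carrier G" "z \<in> carrier G" for x y z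
  proof -
    have "y \<otimes> (inv y \<otimes> z) = z" using that(4,5) by (simp add: m_assoc[symmetric])
    then have "(inv x \<otimes> y) \<otimes> (inv y \<otimes> z) = inv x \<otimes> z" using that(3-5) by (simp add: m_assoc)
    then show ?thesis using subgroup.m_closed[OF H that(1,2)] by simp
  qed
  define rep where "rep x = (SOME g. g \<in> carrier G \<and> inv x \<otimes> g \<in> H)" for x
  have rep: "rep x \<in> carrier G" "inv x \<otimes> rep x \<in> H" if "x \<in> carrier G" for x
  proof -
    have "x \<in> carrier G \<and> inv x \<otimes> x \<in> H" using that subgroup.one_closed[OF H] by simp
    from someI[of "\<lambda>g. g \<in> carrier G \<and> inv x \<otimes> g \<in> H", OF this]
    show "rep x \<in> carrier G" "inv x \<otimes> rep x \<in> H" unfolding rep_def by auto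
  qed
  have rep_eq: "rep x = rep y" if "inv x \<otimes> y \<in> H" "x \<in> carrier G" "y \<in> carrier G" for x y
  proof -
    have "(g \<in> carrier G \<and> inv x \<otimes> g \<in> H) \<longleftrightarrow> (g \<in> carrier G \<and> inv y \<otimes> g \<in> H)" for g
      using that sym trans by blast
    then show ?thesis unfolding rep_def by simp
  qed
  show thesis
  proof (rule that[of "rep ` carrier G"])
    show "rep ` carrier G \<subseteq> carrier G" using rep by auto
    show "\<forall>x\<in>carrier G. \<exists>g\<in>rep ` carrier G. inv g \<otimes> x \<in> H"
      using rep sym by blast
    show "\<forall>g\<in>rep ` carrier G. \<forall>g'\<in>rep ` carrier G. inv g \<otimes> g' \<in> H \<longrightarrow> g = g'"
    proof (intro ballI impI)
      fix g g' assume "g \<in> rep ` carrier G" "g' \<in> rep ` carrier G" and gg': "inv g \<otimes> g' \<in> H"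
      then obtain x x' where x: "x \<in> carrier G" "g = rep x" "x' \<in> carrier G" "g' = rep x'" by auto
      then have "inv x \<otimes> x' \<in> H" using gg' rep sym trans by meson
      then show "g = g'" using x rep_eq by simp
    qed
  qed
qed

text \<open>Expanding the square leaves sums of \<open>b (inv g \<otimes> g')\<close> over the
  fibre. For distinct \<open>g\<close> and \<open>g'\<close> in \<open>R\<close> the argument lies
  outside \<open>H\<close>, so \<open>sum_extensions\<close> removes all mixed terms.\<close>

lemma parseval_extensions:
  assumes H: "subgroup H G" and c: "character_on G H c" and d: "Coset.order G = d * card H"
    and R: "R \<subseteq> carrier G" "\<And>g g'. g \<in> R \<Longrightarrow> g' \<in> R \<Longrightarrow> inv g \<otimes> g' \<in> H \<Longrightarrow> g = g'"
  shows "(\<Sum>b\<in>extensions H c. (cmod (\<Sum>g\<in>R. cnj (b g) * S g))\<^sup>2) = real d * (\<Sum>g\<in>R. (cmod (S g))\<^sup>2)"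
proof -
  have finR: "finite R" using R(1) finite_carrier by (rule finite_subset)
  have b: "cnj (b g) * b g' = b (inv g \<otimes> g')" if "b \<in> extensions H c" "g \<in> R" "g' \<in> R" for b g g'
  proof -
    have "character_on G (carrier G) b" using that(1) by (simp add: extensions_def dual_group_character_on)
    moreover have "g \<in> carrier G" "g' \<in> carrier G" using that R(1) by auto
    ultimately show ?thesis
      using character_on_inv[OF subgroup_self, of b g] by (simp add: character_on_def)
  qed
  have inner: "(\<Sum>b\<in>extensions H c. b (inv g \<otimes> g')) = (if g = g' then of_nat d else 0)"
    if "g \<in> R" "g' \<in> R" for g g'
  proof -
    have g: "g \<in> carrier G" "g' \<in> carrier G" using that R(1) by auto
    have "inv g \<otimes> g' \<in> H \<longleftrightarrow> g = g'"
      using R(2)[OF that] g subgroup.one_closed[OF H] by auto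
    then show ?thesis
      using sum_extensions[OF H c d, of "inv g \<otimes> g'"] g character_on_one[OF H c] by auto
  qed
  have "complex_of_real (\<Sum>b\<in>extensions H c. (cmod (\<Sum>g\<in>R. cnj (b g) * S g))\<^sup>2) =
      (\<Sum>b\<in>extensions H c. (\<Sum>g\<in>R. cnj (b g) * S g) * cnj (\<Sum>g'\<in>R. cnj (b g') * S g'))"
    by (simp add: complex_norm_square del: of_real_power cnj_sum)
  also have "\<dots> = (\<Sum>b\<in>extensions H c. \<Sum>g\<in>R. \<Sum>g'\<in>R. (S g * cnj (S g')) * (cnj (b g) * b g'))"
    unfolding cnj_sum sum_product by (intro sum.cong refl) simp
  also have "\<dots> = (\<Sum>b\<in>extensions H c. \<Sum>g\<in>R. \<Sum>g'\<in>R. (S g * cnj (S g')) * b (inv g \<otimes> g'))"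
    by (intro sum.cong refl) (simp add: b)
  also have "\<dots> = (\<Sum>g\<in>R. \<Sum>b\<in>extensions H c. \<Sum>g'\<in>R. (S g * cnj (S g')) * b (inv g \<otimes> g'))"
    by (rule sum.swap)
  also have "\<dots> = (\<Sum>g\<in>R. \<Sum>g'\<in>R. \<Sum>b\<in>extensions H c. (S g * cnj (S g')) * b (inv g \<otimes> g'))"
    by (intro sum.cong refl sum.swap)
  also have "\<dots> = (\<Sum>g\<in>R. \<Sum>g'\<in>R. if g = g' then (S g * cnj (S g')) * of_nat d else 0)"
    by (intro sum.cong refl) (simp add: sum_distrib_left[symmetric] inner)
  also have "\<dots> = (\<Sum>g\<in>R. S g * cnj (S g) * of_nat d)"
    using finR by simp
  also have "\<dots> = complex_of_real (real d * (\<Sum>g\<in>R. (cmod (S g))\<^sup>2))"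
    by (simp add: complex_norm_square sum_distrib_left mult_ac del: of_real_power)
  finally show ?thesis using of_real_eq_iff by blast
qed

end

text \<open>\<open>C\<close> is the simultaneous basis, \<open>d\<close> the index of
  \<open>H\<close>, and \<open>R\<close> a transversal of the cosets of \<open>H\<close>.\<close>

locale multi_tile = finite_comm_group G for G (structure) +
  fixes H E :: "'a set" and l :: nat and C :: "('a \<Rightarrow> complex) set" and d :: nat and R :: "'a set"
  assumes H: "subgroup H G" and E: "E \<subseteq> carrier G" and tiles: "multi_tiles G E H l" and l: "l > 1"
    and basis: "simultaneous_basis (G\<lparr>carrier := H\<rparr>) (cross_sections G H E) C"
    and d: "Coset.order G = d * card H"
    and R: "R \<subseteq> carrier G" "\<And>x. x \<in> carrier G \<Longrightarrow> \<exists>g\<in>R. inv g \<otimes> x \<in> H"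
      "\<And>g g'. g \<in> R \<Longrightarrow> g' \<in> R \<Longrightarrow> inv g \<otimes> g' \<in> H \<Longrightarrow> g = g'"
begin

definition section_at :: "'a \<Rightarrow> 'a set" where
  "section_at g = {y \<in> H. g \<otimes> y \<in> E}"

text \<open>Columns are indexed by \<open>C\<close> and not by the set of powers, since the
  \<open>s\<close>-th powers of different characters may coincide.\<close>

definition power_mat :: "nat \<Rightarrow> 'a set \<Rightarrow> complex mat" where
  "power_mat s F = mat l l (\<lambda>(i, j). (enumeration C ! j) (enumeration F ! i) ^ s)"

text \<open>The squared norm of the adjoint of \<open>power_mat s F\<close> applied to
  \<open>f\<close>, written over sets so that it is free of enumerations.\<close>

definition energy :: "nat \<Rightarrow> 'a set \<Rightarrow> ('a \<Rightarrow> complex) \<Rightarrow> real" where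
  "energy s F f = (\<Sum>c\<in>C. (cmod (\<Sum>y\<in>F. cnj (c y ^ s) * f y))\<^sup>2)"

definition lift :: "nat \<Rightarrow> ('a \<Rightarrow> complex) set" where
  "lift s = (\<Union>c\<in>C. extensions H (\<lambda>x. c x ^ s))"

lemma H_carrier: "h \<in> H \<Longrightarrow> h \<in> carrier G"
  using H by (rule subgroup.mem_carrier)

lemma finite_H: "finite H"
  using subgroup.subset[OF H] finite_carrier by (rule finite_subset)

lemma finite_E: "finite E"
  using E finite_carrier by (rule finite_subset)

lemma finite_R: "finite R"
  using R(1) finite_carrier by (rule finite_subset)

lemma section_at_subset: "section_at g \<subseteq> H"
  unfolding section_at_def by auto

lemma cross_section_eq:
  assumes g: "g \<in> carrier G"
  shows "inv g <# (E \<inter> (g <# H)) = section_at g"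
proof
  show "inv g <# (E \<inter> (g <# H)) \<subseteq> section_at g"
    using g H_carrier by (auto simp: l_coset_def section_at_def m_assoc[symmetric])
  show "section_at g \<subseteq> inv g <# (E \<inter> (g <# H))"
  proof
    fix y assume y: "y \<in> section_at g"
    then have "y = inv g \<otimes> (g \<otimes> y)" "y \<in> H" "g \<otimes> y \<in> E"
      using g H_carrier by (auto simp: section_at_def m_assoc[symmetric])
    then show "y \<in> inv g <# (E \<inter> (g <# H))" by (auto simp: l_coset_def)
  qed
qed

lemma cross_sections_eq: "cross_sections G H E = section_at ` carrier G"
  unfolding cross_sections_def using cross_section_eq by blast

lemma card_section_at:
  assumes g: "g \<in> carrier G"
  shows "card (section_at g) = l"
proof -
  have "bij_betw (\<lambda>y. g \<otimes> y) (section_at g) (E \<inter> (g <# H))"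
    using g H_carrier by (intro bij_betwI[where g = "\<lambda>x. inv g \<otimes> x"])
      (auto simp: section_at_def l_coset_def m_assoc[symmetric])
  then show ?thesis
    using bij_betw_same_card tiles g unfolding multi_tiles_def by metis
qed

lemma C_dual: "c \<in> C \<Longrightarrow> c \<in> extensional H \<and> character_on G H c"
  using basis unfolding simultaneous_basis_def dual_group_subgroup_iff[symmetric] by auto

lemma C_mult: "c \<in> C \<Longrightarrow> x \<in> H \<Longrightarrow> y \<in> H \<Longrightarrow> c (x \<otimes> y) = c x * c y"
  and C_norm: "c \<in> C \<Longrightarrow> x \<in> H \<Longrightarrow> cmod (c x) = 1"
  using C_dual unfolding character_on_def by auto

lemma C_power: "c \<in> C \<Longrightarrow> character_on G H (\<lambda>x. c x ^ s)"
  unfolding character_on_def by (auto simp: C_mult C_norm power_mult_distrib norm_power)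

lemma section_basis:
  assumes "g \<in> carrier G"
  shows "card C = l" "invertible_mat (char_mat (section_at g) C)"
  using basis assms card_section_at
  unfolding simultaneous_basis_def basis_pair_def cross_sections_eq by auto

lemma card_C: "card C = l"
  using section_basis(1)[OF one_closed] .

lemma finite_C: "finite C"
  using card_C l by (metis card.infinite not_less_zero)

lemma det_power_mat_1:
  assumes g: "g \<in> carrier G"
  shows "det (power_mat 1 (section_at g)) \<noteq> 0"
proof -
  have "char_mat (section_at g) C = power_mat 1 (section_at g)"
    unfolding char_mat_def power_mat_def card_C card_section_at[OF g] by simp
  moreover have "power_mat 1 (section_at g) \<in> carrier_mat l l" unfolding power_mat_def by simp
  moreover from calculation obtain A where
    "power_mat 1 (section_at g) * A = 1\<^sub>m l" "A * power_mat 1 (section_at g) = 1\<^sub>m (dim_row A)"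
    using section_basis(2)[OF g] unfolding invertible_mat_def inverts_mat_def by auto
  moreover from calculation have "A \<in> carrier_mat l l"
    by (metis carrier_matI carrier_matD index_mult_mat(2,3) index_one_mat(2,3))
  ultimately show ?thesis
    using det_mult[of "power_mat 1 (section_at g)" l A] by auto
qed

lemma norm_power_mat:
  assumes "F \<subseteq> H" "card F = l" "i < l" "j < l"
  shows "cmod (power_mat s F $$ (i, j)) = 1"
proof -
  have "finite F" using assms finite_H finite_subset by blast
  then have "enumeration F ! i \<in> H" "enumeration C ! j \<in> C"
    using assms enumeration[of F] enumeration[OF finite_C] card_C by (auto intro: nth_mem)
  then show ?thesis using assms C_norm by (simp add: power_mat_def norm_power)
qed

lemma frobenius_power_mat:
  assumes "F \<subseteq> H" "card F = l"
  shows "(\<Sum>i<l. \<Sum>j<l. (cmod (power_mat s F $$ (i, j)))\<^sup>2) = (real l)\<^sup>2"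
  using norm_power_mat[OF assms] by (simp add: power2_eq_square)

lemma det_power_mat_le:
  assumes "F \<subseteq> H" "card F = l"
  shows "(cmod (det (power_mat s F)))\<^sup>2 \<le> real l ^ l"
  using cmod_det_sq_le_frobenius[of "power_mat s F" l] frobenius_power_mat[OF assms, of s] l
  by (simp add: power_mat_def power2_eq_square)

text \<open>\<open>q\<close> is the Rayleigh quotient at \<open>f\<close> of \<open>A\<close> times
  its adjoint, where \<open>A = power_mat s F\<close>. In coordinates, \<open>f\<close> divided by
  its norm is a unit vector to which \<open>cmod_det_sq_le_rayleigh\<close> applies.\<close>

lemma energy_bounds:
  assumes F: "F \<subseteq> H" "card F = l" and det: "det (power_mat s F) \<noteq> 0"
    and f: "(\<Sum>y\<in>F. (cmod (f y))\<^sup>2) > 0"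
  defines "q \<equiv> energy s F f / (\<Sum>y\<in>F. (cmod (f y))\<^sup>2)"
  shows "0 < q" "q < (real l)\<^sup>2"
    "(cmod (det (power_mat s F)))\<^sup>2 \<le> q * (((real l)\<^sup>2 - q) / (real l - 1)) ^ (l - 1)"
proof -
  have finF: "finite F" using F finite_H finite_subset by blast
  define N where "N = (\<Sum>y\<in>F. (cmod (f y))\<^sup>2)"
  have N: "N > 0" using f unfolding N_def .
  have A: "power_mat s F \<in> carrier_mat l l" unfolding power_mat_def by simp
  define x where "x = vec l (\<lambda>i. f (enumeration F ! i) / sqrt N)"
  have x: "x \<in> carrier_vec l" unfolding x_def by simp
  have "(vec_norm2 x)\<^sup>2 = (\<Sum>i<card F. (cmod (f (enumeration F ! i)))\<^sup>2 / N)"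
    unfolding vec_norm2_sq x_def using N F by (simp add: norm_divide power_divide)
  also have "\<dots> = (\<Sum>y\<in>F. (cmod (f y))\<^sup>2 / N)"
    by (rule sum_enumeration[OF finF])
  also have "\<dots> = 1" using N by (simp add: N_def sum_divide_distrib[symmetric])
  finally have x1: "vec_norm2 x = 1" using vec_norm2_nonneg[of x] by (simp add: power2_eq_1_iff)
  have Ax: "(mat_adjoint (power_mat s F) *\<^sub>v x) $ j =
      (\<Sum>y\<in>F. cnj ((enumeration C ! j) y ^ s) * f y) / sqrt N" if "j < l" for j
  proof -
    have "(mat_adjoint (power_mat s F) *\<^sub>v x) $ j =
        (\<Sum>i<card F. cnj ((enumeration C ! j) (enumeration F ! i) ^ s) * f (enumeration F ! i) / sqrt N)"
      using that A F(2) unfolding x_def power_mat_def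
      by (simp add: mat_adjoint_eq scalar_prod_def lessThan_atLeast0)
    also have "\<dots> = (\<Sum>y\<in>F. cnj ((enumeration C ! j) y ^ s) * f y / sqrt N)"
      by (rule sum_enumeration[OF finF])
    finally show ?thesis by (simp add: sum_divide_distrib)
  qed
  have "(vec_norm2 (mat_adjoint (power_mat s F) *\<^sub>v x))\<^sup>2 =
      (\<Sum>j<card C. (cmod (\<Sum>y\<in>F. cnj ((enumeration C ! j) y ^ s) * f y))\<^sup>2 / N)"
    unfolding vec_norm2_sq card_C using A N
      mat_adjoint_carrier[OF A]
    by (intro sum.cong) (auto simp: Ax norm_divide power_divide simp del: index_mult_mat_vec)
  also have "\<dots> = (\<Sum>c\<in>C. (cmod (\<Sum>y\<in>F. cnj (c y ^ s) * f y))\<^sup>2 / N)"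
    by (rule sum_enumeration[OF finite_C])
  also have "\<dots> = q" unfolding q_def energy_def N_def by (simp add: sum_divide_distrib)
  finally have q: "(vec_norm2 (mat_adjoint (power_mat s F) *\<^sub>v x))\<^sup>2 = q" .
  show "0 < q" "q < (real l)\<^sup>2"
    "(cmod (det (power_mat s F)))\<^sup>2 \<le> q * (((real l)\<^sup>2 - q) / (real l - 1)) ^ (l - 1)"
    using cmod_det_sq_le_rayleigh[OF A l det x x1] unfolding q frobenius_power_mat[OF F] by auto
qed

text \<open>Translation by \<open>h\<close> multiplies the sum belonging to \<open>c\<close> by a
  constant of modulus 1. Bounds for one cross section thus hold for its whole translation
  class.\<close>

lemma energy_translate:
  assumes F: "F \<subseteq> H" and h: "h \<in> H"
  shows "energy s (h <# F) f = energy s F (\<lambda>y. f (h \<otimes> y))"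
    and "(\<Sum>y\<in>h <# F. (cmod (f y))\<^sup>2) = (\<Sum>y\<in>F. (cmod (f (h \<otimes> y)))\<^sup>2)"
proof -
  have inj: "inj_on (\<lambda>y. h \<otimes> y) F"
    using F h H_carrier by (intro inj_onI) (auto simp: subset_iff)
  have eq: "h <# F = (\<lambda>y. h \<otimes> y) ` F" unfolding l_coset_def by auto
  show "(\<Sum>y\<in>h <# F. (cmod (f y))\<^sup>2) = (\<Sum>y\<in>F. (cmod (f (h \<otimes> y)))\<^sup>2)"
    unfolding eq by (simp add: sum.reindex[OF inj])
  have "cmod (\<Sum>y\<in>h <# F. cnj (c y ^ s) * f y) = cmod (\<Sum>y\<in>F. cnj (c y ^ s) * f (h \<otimes> y))"
    if c: "c \<in> C" for c
  proof -
    have "(\<Sum>y\<in>h <# F. cnj (c y ^ s) * f y) = (\<Sum>y\<in>F. cnj (c (h \<otimes> y) ^ s) * f (h \<otimes> y))"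
      unfolding eq by (simp add: sum.reindex[OF inj])
    also have "\<dots> = (\<Sum>y\<in>F. cnj (c h ^ s) * (cnj (c y ^ s) * f (h \<otimes> y)))"
      using F h c by (intro sum.cong refl) (auto simp: C_mult power_mult_distrib subset_iff)
    also have "\<dots> = cnj (c h ^ s) * (\<Sum>y\<in>F. cnj (c y ^ s) * f (h \<otimes> y))"
      by (rule sum_distrib_left[symmetric])
    finally show ?thesis using C_norm[OF c h] by (simp add: norm_mult norm_power)
  qed
  then show "energy s (h <# F) f = energy s F (\<lambda>y. f (h \<otimes> y))"
    unfolding energy_def by simp
qed

section \<open>Decomposition along the cosets\<close>

text \<open>Used with \<open>A = E\<close> to split sums over \<open>E\<close> into cross sections,
  and with the whole carrier to count \<open>R\<close>.\<close>

lemma bij_betw_tile: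
  assumes "A \<subseteq> carrier G"
  shows "bij_betw (\<lambda>(g, y). g \<otimes> y) (SIGMA g:R. {y \<in> H. g \<otimes> y \<in> A}) A"
  unfolding bij_betw_def
proof
  have gc: "g \<in> carrier G" if "g \<in> R" for g using that R(1) by auto
  show "inj_on (\<lambda>(g, y). g \<otimes> y) (SIGMA g:R. {y \<in> H. g \<otimes> y \<in> A})"
  proof (rule inj_onI, clarify)
    fix g y g' y' assume g: "g \<in> R" "g' \<in> R" and y: "y \<in> H" "y' \<in> H" and eq: "g \<otimes> y = g' \<otimes> y'"
    have "inv g \<otimes> g' = inv g \<otimes> (g' \<otimes> y') \<otimes> inv y'"
      using g y gc H_carrier by (simp add: m_assoc)
    also have "\<dots> = y \<otimes> inv y'"
      using g y gc H_carrier by (simp add: eq[symmetric] m_assoc[symmetric])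
    finally have "inv g \<otimes> g' \<in> H" using y H by (simp add: subgroup.m_closed subgroup.m_inv_closed)
    then have "g = g'" using R(3) g by blast
    then show "g = g' \<and> y = y'" using eq g y gc H_carrier by simp
  qed
  show "(\<lambda>(g, y). g \<otimes> y) ` (SIGMA g:R. {y \<in> H. g \<otimes> y \<in> A}) = A"
  proof
    show "A \<subseteq> (\<lambda>(g, y). g \<otimes> y) ` (SIGMA g:R. {y \<in> H. g \<otimes> y \<in> A})"
    proof
      fix x assume x: "x \<in> A"
      then have xc: "x \<in> carrier G" using assms by auto
      then obtain g where g: "g \<in> R" "inv g \<otimes> x \<in> H" using R(2) by blast
      have "x = g \<otimes> (inv g \<otimes> x)" using gc[OF g(1)] xc by (simp add: m_assoc[symmetric])
      then show "x \<in> (\<lambda>(g, y). g \<otimes> y) ` (SIGMA g:R. {y \<in> H. g \<otimes> y \<in> A})"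
        using g x by (intro image_eqI[of _ _ "(g, inv g \<otimes> x)"]) auto
    qed
  qed auto
qed

lemma sum_E: "(\<Sum>x\<in>E. f x) = (\<Sum>g\<in>R. \<Sum>y\<in>section_at g. f (g \<otimes> y))"
proof -
  have "(\<Sum>x\<in>E. f x) = (\<Sum>(g, y)\<in>(SIGMA g:R. section_at g). f (g \<otimes> y))"
    using sum.reindex_bij_betw[OF bij_betw_tile[OF E], of f, symmetric]
    unfolding section_at_def by (simp add: case_prod_unfold)
  also have "\<dots> = (\<Sum>g\<in>R. \<Sum>y\<in>section_at g. f (g \<otimes> y))"
    by (subst sum.Sigma) (use finite_R finite_subset[OF section_at_subset finite_H] in auto)
  finally show ?thesis .
qed

lemma card_R: "card R = d"
proof -
  have "(SIGMA g:R. {y \<in> H. g \<otimes> y \<in> carrier G}) = R \<times> H"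
    using R(1) H_carrier by auto
  then have "card R * card H = Coset.order G"
    using bij_betw_same_card[OF bij_betw_tile[OF subset_refl]] by (simp add: Coset.order_def card_cartesian_product)
  moreover have "card H > 0"
    using finite_H subgroup.one_closed[OF H] by (auto simp: card_gt_0_iff)
  ultimately show ?thesis using d by simp
qed

lemma d_pos: "d > 0"
  using d finite_carrier order_gt_0_iff_finite by (metis mult_0 not_gr_zero)

lemma card_E: "card E = l * d"
proof -
  have "card E = (\<Sum>g\<in>R. card (section_at g))"
    using sum_E[of "\<lambda>_. 1 :: nat"] by simp
  also have "\<dots> = (\<Sum>g\<in>R. l)" using R(1) by (intro sum.cong refl card_section_at) auto
  finally show ?thesis by (simp add: card_R mult.commute)
qed

lemma E_pos: "card E > 0"
  using card_E d_pos l by simp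

text \<open>A common extension would force the two \<open>s\<close>-th powers to agree on
  \<open>H\<close>, giving \<open>power_mat s F\<close> two equal columns.\<close>

lemma extensions_disjoint:
  assumes F: "F \<subseteq> H" "card F = l" and det: "det (power_mat s F) \<noteq> 0"
    and c: "c \<in> C" "c' \<in> C" "c \<noteq> c'"
  shows "extensions H (\<lambda>x. c x ^ s) \<inter> extensions H (\<lambda>x. c' x ^ s) = {}"
proof (rule ccontr)
  assume "\<not> ?thesis"
  then have eq: "c x ^ s = c' x ^ s" if "x \<in> H" for x
    using that unfolding extensions_def by force
  have finF: "finite F" using F finite_H finite_subset by blast
  obtain j j' where j: "j < l" "enumeration C ! j = c" "j' < l" "enumeration C ! j' = c'"
    using c(1,2) enumeration[OF finite_C] card_C by (metis in_set_conv_nth)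
  then have "j \<noteq> j'" using c(3) by auto
  moreover have "col (power_mat s F) j = col (power_mat s F) j'"
  proof (rule eq_vecI)
    fix i assume "i < dim_vec (col (power_mat s F) j')"
    then have i: "i < l" by (simp add: power_mat_def)
    then have "enumeration F ! i \<in> H"
      using enumeration[OF finF] F by (metis nth_mem subsetD)
    then show "col (power_mat s F) j $ i = col (power_mat s F) j' $ i"
      using i j eq by (simp add: power_mat_def)
  qed (simp add: power_mat_def)
  ultimately have "det (power_mat s F) = 0"
    using j by (intro det_identical_columns[of _ l j j']) (auto simp: power_mat_def)
  then show False using det by simp
qed

lemma sum_lift:
  assumes "F \<subseteq> H" "card F = l" "det (power_mat s F) \<noteq> 0"
  shows "(\<Sum>b\<in>lift s. f b) = (\<Sum>c\<in>C. \<Sum>b\<in>extensions H (\<lambda>x. c x ^ s). f b)"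
  unfolding lift_def using extensions_disjoint[OF assms] finite_C finite_extensions
  by (intro sum.UNION_disjoint) auto

lemma lift_subset: "lift s \<subseteq> dual_group G"
  unfolding lift_def extensions_def by auto

lemma finite_lift: "finite (lift s)"
  using lift_subset finite_dual_group by (rule finite_subset)

text \<open>The \<open>l\<close> powers are distinct and have \<open>d\<close> extensions each. This
  makes \<open>lift s\<close> admissible in the minima over sets of characters.\<close>

lemma card_lift:
  assumes "F \<subseteq> H" "card F = l" "det (power_mat s F) \<noteq> 0"
  shows "card (lift s) = card E"
proof -
  have "card (lift s) = (\<Sum>c\<in>C. card (extensions H (\<lambda>x. c x ^ s)))"
    using sum_lift[OF assms, of "\<lambda>_. 1 :: nat"] by simp
  also have "\<dots> = (\<Sum>c\<in>C. d)"
    by (intro sum.cong refl card_extensions[OF H C_power d])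
  finally show ?thesis by (simp add: card_C card_E)
qed

text \<open>The block structure as an identity of quadratic forms: since
  \<open>b (g \<otimes> y) = b g * c y ^ s\<close>, the inner sum splits over the transversal, and
  Parseval's identity on each fibre separates the cosets.\<close>

lemma energy_E:
  assumes F: "F \<subseteq> H" "card F = l" "det (power_mat s F) \<noteq> 0"
  shows "(\<Sum>b\<in>lift s. (cmod (\<Sum>x\<in>E. cnj (b x) * f x))\<^sup>2) =
    real d * (\<Sum>g\<in>R. energy s (section_at g) (\<lambda>y. f (g \<otimes> y)))"
proof -
  define S where "S c g = (\<Sum>y\<in>section_at g. cnj (c y ^ s) * f (g \<otimes> y))" for c g
  have "(\<Sum>x\<in>E. cnj (b x) * f x) = (\<Sum>g\<in>R. cnj (b g) * S c g)"
    if b: "b \<in> extensions H (\<lambda>x. c x ^ s)" for b c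
  proof -
    have "(\<Sum>x\<in>E. cnj (b x) * f x) = (\<Sum>g\<in>R. \<Sum>y\<in>section_at g. cnj (b (g \<otimes> y)) * f (g \<otimes> y))"
      by (rule sum_E)
    also have "\<dots> = (\<Sum>g\<in>R. \<Sum>y\<in>section_at g. cnj (b g) * (cnj (c y ^ s) * f (g \<otimes> y)))"
    proof (intro sum.cong refl)
      fix g y assume g: "g \<in> R" and y: "y \<in> section_at g"
      then have "y \<in> H" using section_at_subset by auto
      then have "b (g \<otimes> y) = b g * c y ^ s"
        using b g R(1) H_carrier unfolding extensions_def dual_group_iff by auto
      then show "cnj (b (g \<otimes> y)) * f (g \<otimes> y) = cnj (b g) * (cnj (c y ^ s) * f (g \<otimes> y))" by simp
    qed
    finally show ?thesis unfolding S_def by (simp add: sum_distrib_left)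
  qed
  then have "(\<Sum>b\<in>lift s. (cmod (\<Sum>x\<in>E. cnj (b x) * f x))\<^sup>2) =
      (\<Sum>c\<in>C. \<Sum>b\<in>extensions H (\<lambda>x. c x ^ s). (cmod (\<Sum>g\<in>R. cnj (b g) * S c g))\<^sup>2)"
    unfolding sum_lift[OF F] by (intro sum.cong refl) simp
  also have "\<dots> = (\<Sum>c\<in>C. real d * (\<Sum>g\<in>R. (cmod (S c g))\<^sup>2))"
    by (intro sum.cong refl parseval_extensions[OF H C_power d R(1,3)])
  also have "\<dots> = real d * (\<Sum>c\<in>C. \<Sum>g\<in>R. (cmod (S c g))\<^sup>2)"
    by (rule sum_distrib_left[symmetric])
  also have "(\<Sum>c\<in>C. \<Sum>g\<in>R. (cmod (S c g))\<^sup>2) = (\<Sum>g\<in>R. \<Sum>c\<in>C. (cmod (S c g))\<^sup>2)"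
    by (rule sum.swap)
  finally show ?thesis unfolding energy_def S_def .
qed

lemma char_mat_carrier:
  assumes "F \<subseteq> H" "card F = l" "det (power_mat s F) \<noteq> 0"
  shows "char_mat E (lift s) \<in> carrier_mat (card E) (card E)"
  unfolding char_mat_def card_lift[OF assms] by simp

lemma vec_norm2_char_mat:
  assumes F: "F \<subseteq> H" "card F = l" "det (power_mat s F) \<noteq> 0" and w: "w \<in> carrier_vec (card E)"
  obtains f where "(vec_norm2 w)\<^sup>2 = (\<Sum>g\<in>R. \<Sum>y\<in>section_at g. (cmod (f (g \<otimes> y)))\<^sup>2)"
    "(vec_norm2 (mat_adjoint (char_mat E (lift s)) *\<^sub>v w))\<^sup>2 =
       real d * (\<Sum>g\<in>R. energy s (section_at g) (\<lambda>y. f (g \<otimes> y)))"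
proof -
  \<comment> \<open>The vector \<open>w\<close> read as a function on \<open>E\<close>, by inverting
    the enumeration.\<close>
  define f where "f x = w $ (inv_into {..<card E} ((!) (enumeration E)) x)" for x
  have f: "f (enumeration E ! i) = w $ i" if "i < card E" for i
    unfolding f_def using that bij_betw_enumeration[OF finite_E]
    by (simp add: bij_betw_def inv_into_f_f)
  have "(vec_norm2 w)\<^sup>2 = (\<Sum>i<card E. (cmod (f (enumeration E ! i)))\<^sup>2)"
    unfolding vec_norm2_sq using w f by (intro sum.cong) auto
  also have "\<dots> = (\<Sum>x\<in>E. (cmod (f x))\<^sup>2)" by (rule sum_enumeration[OF finite_E])
  also have "\<dots> = (\<Sum>g\<in>R. \<Sum>y\<in>section_at g. (cmod (f (g \<otimes> y)))\<^sup>2)" by (rule sum_E)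
  finally have 1: "(vec_norm2 w)\<^sup>2 = \<dots>" .
  have T: "char_mat E (lift s) \<in> carrier_mat (card E) (card E)" by (rule char_mat_carrier[OF F])
  have Tw: "(mat_adjoint (char_mat E (lift s)) *\<^sub>v w) $ j = (\<Sum>x\<in>E. cnj ((enumeration (lift s) ! j) x) * f x)"
    if "j < card E" for j
  proof -
    have "(mat_adjoint (char_mat E (lift s)) *\<^sub>v w) $ j =
        (\<Sum>i<card E. cnj ((enumeration (lift s) ! j) (enumeration E ! i)) * f (enumeration E ! i))"
      using that w T f unfolding char_mat_def card_lift[OF F]
      by (simp add: mat_adjoint_eq scalar_prod_def lessThan_atLeast0)
    also have "\<dots> = (\<Sum>x\<in>E. cnj ((enumeration (lift s) ! j) x) * f x)"
      by (rule sum_enumeration[OF finite_E])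
    finally show ?thesis .
  qed
  have "(vec_norm2 (mat_adjoint (char_mat E (lift s)) *\<^sub>v w))\<^sup>2 =
      (\<Sum>j<card (lift s). (cmod (\<Sum>x\<in>E. cnj ((enumeration (lift s) ! j) x) * f x))\<^sup>2)"
    unfolding vec_norm2_sq card_lift[OF F] using mat_adjoint_carrier[OF T]
    by (intro sum.cong) (auto simp: Tw simp del: index_mult_mat_vec)
  also have "\<dots> = (\<Sum>b\<in>lift s. (cmod (\<Sum>x\<in>E. cnj (b x) * f x))\<^sup>2)"
    by (rule sum_enumeration[OF finite_lift])
  also have "\<dots> = real d * (\<Sum>g\<in>R. energy s (section_at g) (\<lambda>y. f (g \<otimes> y)))"
    by (rule energy_E[OF F])
  finally show thesis using that 1 by blast
qed

text \<open>\<open>char_mat E (lift s)\<close> times its adjoint, divided by \<open>d\<close>,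
  whenever \<open>lift s\<close> has the right size. The formula makes sense for every
  \<open>s\<close>, also when powers coincide, as is needed for its determinant to be a function in
  \<open>cyclotomic\<close>.\<close>

definition gram :: "nat \<Rightarrow> complex mat" where
  "gram s = mat (card E) (card E) (\<lambda>(i, j). let y = enumeration E ! i \<otimes> inv (enumeration E ! j)
     in if y \<in> H then \<Sum>c\<in>C. c y ^ s else 0)"

text \<open>An entry is the sum of \<open>b (x \<otimes> inv x')\<close> over \<open>lift s\<close>,
  which \<open>sum_extensions\<close> evaluates fibre by fibre.\<close>

lemma char_mat_gram:
  assumes F: "F \<subseteq> H" "card F = l" "det (power_mat s F) \<noteq> 0"
  shows "char_mat E (lift s) * mat_adjoint (char_mat E (lift s)) = of_nat d \<cdot>\<^sub>m gram s"
proof (rule eq_matI)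
  let ?T = "char_mat E (lift s)"
  have T: "?T \<in> carrier_mat (card E) (card E)" by (rule char_mat_carrier[OF F])
  fix i j assume "i < dim_row (of_nat d \<cdot>\<^sub>m gram s)" "j < dim_col (of_nat d \<cdot>\<^sub>m gram s)"
  then have ij: "i < card E" "j < card E" by (auto simp: gram_def)
  define x where "x = enumeration E ! i"
  define x' where "x' = enumeration E ! j"
  have "x \<in> E" "x' \<in> E"
    using ij enumeration[OF finite_E] unfolding x_def x'_def by (metis nth_mem)+
  then have xc: "x \<in> carrier G" "x' \<in> carrier G" using E by auto
  have "(?T * mat_adjoint ?T) $$ (i, j) =
      (\<Sum>k<card (lift s). (enumeration (lift s) ! k) x * cnj ((enumeration (lift s) ! k) x'))"
    using ij T unfolding char_mat_def card_lift[OF F] x_def x'_def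
    by (simp add: mat_adjoint_eq scalar_prod_def lessThan_atLeast0)
  also have "\<dots> = (\<Sum>b\<in>lift s. b x * cnj (b x'))"
    by (rule sum_enumeration[OF finite_lift])
  also have "\<dots> = (\<Sum>b\<in>lift s. b (x \<otimes> inv x'))"
  proof (intro sum.cong refl)
    fix b assume "b \<in> lift s"
    then have b: "character_on G (carrier G) b"
      using lift_subset dual_group_character_on by blast
    then show "b x * cnj (b x') = b (x \<otimes> inv x')"
      using character_on_inv[OF subgroup_self b xc(2)] xc unfolding character_on_def by simp
  qed
  also have "\<dots> = (\<Sum>c\<in>C. if x \<otimes> inv x' \<in> H then of_nat d * c (x \<otimes> inv x') ^ s else 0)"
    unfolding sum_lift[OF F] using xc by (intro sum.cong refl sum_extensions[OF H C_power d]) auto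
  also have "\<dots> = (of_nat d \<cdot>\<^sub>m gram s) $$ (i, j)"
    using ij by (simp add: gram_def x_def x'_def Let_def sum_distrib_left)
  finally show "(?T * mat_adjoint ?T) $$ (i, j) = (of_nat d \<cdot>\<^sub>m gram s) $$ (i, j)" .
qed (use char_mat_carrier[OF F] in \<open>auto simp: gram_def mat_adjoint_eq\<close>)

lemma cmod_det_char_mat_sq:
  assumes F: "F \<subseteq> H" "card F = l" "det (power_mat s F) \<noteq> 0"
  shows "(cmod (det (char_mat E (lift s))))\<^sup>2 = real d ^ card E * cmod (det (gram s))"
proof -
  let ?T = "char_mat E (lift s)"
  have T: "?T \<in> carrier_mat (card E) (card E)" by (rule char_mat_carrier[OF F])
  have "(cmod (det ?T))\<^sup>2 = cmod (det (?T * mat_adjoint ?T))"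
    using det_mult[OF T mat_adjoint_carrier[OF T]] det_mat_adjoint[OF T]
    by (simp add: norm_mult power2_eq_square)
  also have "\<dots> = real d ^ card E * cmod (det (gram s))"
    unfolding char_mat_gram[OF F] by (simp add: norm_mult norm_power gram_def)
  finally show ?thesis .
qed

section \<open>Determinants as functions of the exponent\<close>

lemma C_root:
  assumes "c \<in> C" "y \<in> H"
  shows "c y ^ Coset.order G = 1"
  using character_on_pow[OF H _ assms(2), of c "Coset.order G"] character_on_one[OF H, of c] C_dual[OF assms(1)]
    pow_order_eq_1[OF H_carrier[OF assms(2)]] by simp

lemma det_power_mat_cyclotomic:
  assumes F: "F \<subseteq> H" "card F = l"
  shows "(\<lambda>s. det (power_mat s F)) \<in> cyclotomic (Coset.order G)"
  unfolding power_mat_def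
proof (rule cyclotomic_det, rule cyclotomic_root, rule C_root)
  fix i j assume "i < l" "j < l"
  moreover have "finite F" using F finite_H finite_subset by blast
  ultimately show "enumeration C ! j \<in> C" "enumeration F ! i \<in> H"
    using F enumeration[of F] enumeration[OF finite_C] card_C by (auto intro: nth_mem)
qed

lemma det_gram_cyclotomic: "(\<lambda>s. det (gram s)) \<in> cyclotomic (Coset.order G)"
  unfolding gram_def
proof (rule cyclotomic_det)
  fix i j
  let ?y = "enumeration E ! i \<otimes> inv (enumeration E ! j)"
  show "(\<lambda>s. let y = ?y in if y \<in> H then \<Sum>c\<in>C. c y ^ s else 0) \<in> cyclotomic (Coset.order G)"
    unfolding Let_def
    by (cases "?y \<in> H") (auto intro!: cyclotomic.zero cyclotomic_sum cyclotomic_root C_root)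
qed

end

section \<open>Bounds for multi-tiles\<close>

context finite_comm_group
begin

lemma min_over_chars_le:
  assumes "B \<subseteq> dual_group G" "card B = card E"
  shows "min_over_chars G Q E \<le> Q E B"
  unfolding min_over_chars_def
proof (rule Min_le)
  have "{Q E B |B. B \<subseteq> dual_group G \<and> card B = card E} \<subseteq> Q E ` Pow (dual_group G)" by auto
  then show "finite {Q E B |B. B \<subseteq> dual_group G \<and> card B = card E}"
    using finite_dual_group by (meson finite_Pow_iff finite_imageI finite_subset)
qed (use assms in auto)

end

context multi_tile
begin

text \<open>By \<open>vec_norm2_char_mat\<close> the quadratic form is \<open>d\<close> times an
  orthogonal sum over the cosets, so bounds that hold uniformly for the blocks pass to the whole
  matrix.\<close>

lemma char_mat_bounds:
  assumes F: "F \<subseteq> H" "card F = l" "det (power_mat s F) \<noteq> 0" and pos: "0 < \<alpha>" "0 < \<beta>"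
    and bounds: "\<And>g f. g \<in> R \<Longrightarrow> \<alpha> * (\<Sum>y\<in>section_at g. (cmod (f y))\<^sup>2) \<le> energy s (section_at g) f"
      "\<And>g f. g \<in> R \<Longrightarrow> energy s (section_at g) f \<le> \<beta> * (\<Sum>y\<in>section_at g. (cmod (f y))\<^sup>2)"
  shows "real d * \<alpha> \<le> L_pair E (lift s)" "U_pair E (lift s) \<le> real d * \<beta>"
proof -
  let ?T = "char_mat E (lift s)"
  have T: "?T \<in> carrier_mat (card E) (card E)" by (rule char_mat_carrier[OF F])
  have dpos: "real d > 0" using d_pos by simp
  have w: "real d * \<alpha> * (vec_norm2 w)\<^sup>2 \<le> (vec_norm2 (mat_adjoint ?T *\<^sub>v w))\<^sup>2 \<and>
      (vec_norm2 (mat_adjoint ?T *\<^sub>v w))\<^sup>2 \<le> real d * \<beta> * (vec_norm2 w)\<^sup>2"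
    if w: "w \<in> carrier_vec (card E)" for w
  proof -
    obtain f where f: "(vec_norm2 w)\<^sup>2 = (\<Sum>g\<in>R. \<Sum>y\<in>section_at g. (cmod (f (g \<otimes> y)))\<^sup>2)"
      "(vec_norm2 (mat_adjoint ?T *\<^sub>v w))\<^sup>2 = real d * (\<Sum>g\<in>R. energy s (section_at g) (\<lambda>y. f (g \<otimes> y)))"
      by (rule vec_norm2_char_mat[OF F w])
    have "\<alpha> * (vec_norm2 w)\<^sup>2 \<le> (\<Sum>g\<in>R. energy s (section_at g) (\<lambda>y. f (g \<otimes> y)))"
      unfolding f(1) sum_distrib_left[of \<alpha> _ R] by (rule sum_mono) (rule bounds(1))
    moreover have "(\<Sum>g\<in>R. energy s (section_at g) (\<lambda>y. f (g \<otimes> y))) \<le> \<beta> * (vec_norm2 w)\<^sup>2"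
      unfolding f(1) sum_distrib_left[of \<beta> _ R] by (rule sum_mono) (rule bounds(2))
    ultimately show ?thesis unfolding f(2) using dpos by (simp add: mult.assoc)
  qed
  show "real d * \<alpha> \<le> L_pair E (lift s)"
    unfolding L_pair_def using w pos dpos
    by (intro sigma_min_sq_ge[OF T E_pos]) auto
  show "U_pair E (lift s) \<le> real d * \<beta>"
    unfolding U_pair_def using w pos dpos by (intro op_norm2_sq_le[OF T]) auto
qed

text \<open>A vector in the kernel of the adjoint would have energy 0 on every cross section, yet
  the energy is positive wherever the corresponding piece of the vector is nonzero.\<close>

lemma det_gram_1: "det (gram 1) \<noteq> 0"
proof -
  let ?T = "char_mat E (lift 1)"
  note F = section_at_subset[of \<one>] card_section_at[OF one_closed] det_power_mat_1[OF one_closed]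
  have T: "?T \<in> carrier_mat (card E) (card E)" by (rule char_mat_carrier[OF F])
  have "det ?T \<noteq> 0"
  proof
    assume "det ?T = 0"
    then have "det (mat_adjoint ?T) = 0" using det_mat_adjoint[OF T] by simp
    then obtain w where w: "w \<in> carrier_vec (card E)" "w \<noteq> 0\<^sub>v (card E)" "mat_adjoint ?T *\<^sub>v w = 0\<^sub>v (card E)"
      using det_0_iff_vec_prod_zero[OF mat_adjoint_carrier[OF T]] by auto
    obtain f where f: "(vec_norm2 w)\<^sup>2 = (\<Sum>g\<in>R. \<Sum>y\<in>section_at g. (cmod (f (g \<otimes> y)))\<^sup>2)"
      "(vec_norm2 (mat_adjoint ?T *\<^sub>v w))\<^sup>2 = real d * (\<Sum>g\<in>R. energy 1 (section_at g) (\<lambda>y. f (g \<otimes> y)))"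
      by (rule vec_norm2_char_mat[OF F w(1)])
    have "vec_norm2 w \<noteq> 0" "vec_norm2 (mat_adjoint ?T *\<^sub>v w) = 0"
      using w vec_norm2_eq_0_iff[of _ "card E"] by auto
    with f have nz: "(\<Sum>g\<in>R. \<Sum>y\<in>section_at g. (cmod (f (g \<otimes> y)))\<^sup>2) \<noteq> 0"
      and "(\<Sum>g\<in>R. energy 1 (section_at g) (\<lambda>y. f (g \<otimes> y))) = 0"
      using d_pos by auto
    then have zero: "energy 1 (section_at g) (\<lambda>y. f (g \<otimes> y)) = 0" if "g \<in> R" for g
      using that finite_R by (subst (asm) sum_nonneg_eq_0_iff) (auto simp: energy_def sum_nonneg)
    from nz obtain g where g: "g \<in> R" "(\<Sum>y\<in>section_at g. (cmod (f (g \<otimes> y)))\<^sup>2) \<noteq> 0"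
      by (meson sum.neutral)
    have gc: "g \<in> carrier G" using g R(1) by auto
    have "(\<Sum>y\<in>section_at g. (cmod (f (g \<otimes> y)))\<^sup>2) > 0"
      using g(2) by (metis sum_nonneg zero_le_power2 order_le_less)
    from energy_bounds(1)[OF section_at_subset card_section_at[OF gc] det_power_mat_1[OF gc] this]
    show False using zero[OF g(1)] by simp
  qed
  then show ?thesis using cmod_det_char_mat_sq[OF F] by auto
qed

text \<open>If \<open>|det (gram s)| \<ge> 1\<close>, then \<open>|det T|^2 \<ge> d ^ card E\<close>
  for \<open>T = char_mat E (lift s)\<close>, so the root of order \<open>card E\<close> is at least
  \<open>sqrt d\<close>; and \<open>card E = l * d\<close>.\<close>

lemma D_norm_le: "D_norm G E \<le> ereal (sqrt (real l))"
proof -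
  have m: "Coset.order G > 0" using finite_carrier order_gt_0_iff_finite by simp
  let ?F = "section_at \<one>"
  note F = section_at_subset[of \<one>] card_section_at[OF one_closed]
  \<comment> \<open>The second function keeps \<open>power_mat s ?F\<close> invertible at the same
    \<open>s\<close>, which guarantees that \<open>lift s\<close> has \<open>card E\<close>
    elements.\<close>
  obtain s where s: "1 \<le> cmod (det (gram s))" "det (power_mat s ?F) \<noteq> 0"
    using cyclotomic_exists_ge_1[OF m det_gram_cyclotomic det_gram_1 det_power_mat_cyclotomic[OF F]
      det_power_mat_1[OF one_closed]] by blast
  define D where "D = D_pair E (lift s)"
  have "real d ^ card E \<le> D\<^sup>2"
    unfolding D_def D_pair_def cmod_det_char_mat_sq[OF F s(2)] using s(1) by (simp add: mult_le_cancel_left1)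
  then have "sqrt (real d ^ card E) \<le> D"
    unfolding D_def D_pair_def by (intro real_le_lsqrt) auto
  then have "root (card E) (sqrt (real d) ^ card E) \<le> root (card E) D"
    using E_pos by (simp add: real_sqrt_power)
  then have root: "sqrt (real d) \<le> root (card E) D"
    using E_pos by (simp add: real_root_power_cancel)
  have dpos: "sqrt (real d) > 0" using d_pos by simp
  have "D_norm G E \<le> D_norm_pair E (lift s)"
    unfolding D_norm_def by (rule min_over_chars_le[OF lift_subset card_lift[OF F s(2)]])
  also have "\<dots> = ereal (sqrt (real (card E)) / root (card E) D)"
    unfolding D_norm_pair_def D_def[symmetric] using root dpos
    by (metis ereal_divide less_le_trans less_irrefl)
  also have "\<dots> \<le> ereal (sqrt (real (card E)) / sqrt (real d))"
    using root dpos by (simp add: frac_le)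
  also have "sqrt (real (card E)) / sqrt (real d) = sqrt (real l)"
    using dpos unfolding card_E by (simp add: real_sqrt_mult)
  finally show ?thesis .
qed

text \<open>The representative is picked among the cross sections that generate the class, so the
  facts about \<open>section_at\<close> apply to it; reflexivity places each cross section in its
  own class.\<close>

lemma section_classes:
  obtains rep where
    "\<forall>X\<in>cross_sections G H E // translation_rel G H. rep X \<in> cross_sections G H E"
    "\<forall>F\<in>cross_sections G H E. \<exists>X\<in>cross_sections G H E // translation_rel G H. \<exists>h\<in>H. F = h <# rep X"
proof -
  let ?r = "translation_rel G H"
  define rep where "rep X = (SOME F. F \<in> cross_sections G H E \<and> X = ?r `` {F})" for X
  have rep: "rep X \<in> cross_sections G H E \<and> X = ?r `` {rep X}" if X: "X \<in> cross_sections G H E // ?r" for X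
  proof -
    obtain F where "F \<in> cross_sections G H E \<and> X = ?r `` {F}" using X unfolding quotient_def by blast
    then show ?thesis unfolding rep_def by (rule someI)
  qed
  show thesis
  proof (rule that[of rep])
    show "\<forall>F\<in>cross_sections G H E. \<exists>X\<in>cross_sections G H E // ?r. \<exists>h\<in>H. F = h <# rep X"
    proof
      fix F assume F: "F \<in> cross_sections G H E"
      then have FH: "F \<subseteq> H" using cross_sections_eq section_at_subset by auto
      have "F = \<one> <# F"
        using FH H_carrier by (auto simp: l_coset_def subset_iff)
      then have "(F, F) \<in> ?r"
        unfolding translation_rel_def using FH subgroup.one_closed[OF H] by auto
      moreover have X: "?r `` {F} \<in> cross_sections G H E // ?r" using F by (rule quotientI)
      ultimately have "(rep (?r `` {F}), F) \<in> ?r" using rep[OF X] by blast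
      then have "\<exists>h\<in>H. F = h <# rep (?r `` {F})" unfolding translation_rel_def by blast
      then show "\<exists>X\<in>cross_sections G H E // ?r. \<exists>h\<in>H. F = h <# rep X" using X by blast
    qed
  qed (use rep in auto)
qed

text \<open>One \<open>s\<close> has to serve all cross sections. The product runs over the
  translation classes, so the resulting exponent depends on \<open>k\<close> and not on the index of
  \<open>H\<close>.\<close>

lemma exists_good_power:
  assumes k: "card (cross_sections G H E // translation_rel G H) = k"
  obtains s rep where "k \<ge> 1"
    "\<forall>X\<in>cross_sections G H E // translation_rel G H.
       rep X \<subseteq> H \<and> card (rep X) = l \<and> 1 / real l ^ ((k - 1) * l) \<le> (cmod (det (power_mat s (rep X))))\<^sup>2"
    "\<forall>F\<in>cross_sections G H E. \<exists>X\<in>cross_sections G H E // translation_rel G H. \<exists>h\<in>H. F = h <# rep X"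
proof -
  let ?Q = "cross_sections G H E // translation_rel G H"
  obtain rep where rep: "\<forall>X\<in>?Q. rep X \<in> cross_sections G H E"
    and cover: "\<forall>F\<in>cross_sections G H E. \<exists>X\<in>?Q. \<exists>h\<in>H. F = h <# rep X"
    by (rule section_classes)
  have finQ: "finite ?Q"
    unfolding cross_sections_eq using finite_carrier by (auto simp: quotient_def)
  have "section_at \<one> \<in> cross_sections G H E" unfolding cross_sections_eq by simp
  then have "?Q \<noteq> {}" using cover by blast
  then have k1: "k \<ge> 1" using finQ k by (metis card_gt_0_iff Suc_leI One_nat_def)
  have repF: "rep X \<subseteq> H \<and> card (rep X) = l \<and> det (power_mat 1 (rep X)) \<noteq> 0" if X: "X \<in> ?Q" for X
  proof -
    obtain g where "g \<in> carrier G" "rep X = section_at g"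
      using bspec[OF rep X] unfolding cross_sections_eq by auto
    then show ?thesis using section_at_subset card_section_at det_power_mat_1 by simp
  qed
  define P where "P s = (\<Prod>X\<in>?Q. det (power_mat s (rep X)))" for s
  have P: "P \<in> cyclotomic (Coset.order G)"
    unfolding P_def using repF by (intro cyclotomic_prod det_power_mat_cyclotomic) auto
  have P1: "P 1 \<noteq> 0"
    unfolding P_def using repF finQ by (simp add: prod_zero_iff)
  have m: "Coset.order G > 0" using finite_carrier order_gt_0_iff_finite by simp
  obtain s where s: "1 \<le> cmod (P s)"
    using cyclotomic_exists_ge_1[OF m P P1 P P1] by blast
  have "1 / real l ^ ((k - 1) * l) \<le> (cmod (det (power_mat s (rep X))))\<^sup>2" if X: "X \<in> ?Q" for X
  proof -
    let ?D = "\<lambda>X. (cmod (det (power_mat s (rep X))))\<^sup>2"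
    have "1 \<le> (cmod (P s))\<^sup>2" using s by (simp add: one_le_power)
    also have "\<dots> = (\<Prod>X\<in>?Q. ?D X)"
      unfolding P_def by (simp add: prod_norm[symmetric] prod_power_distrib)
    \<comment> \<open>Each of the other \<open>k - 1\<close> factors is at most
      \<open>l ^ l\<close>, which leaves a lower bound for the one at \<open>X\<close>.\<close>
    also have "\<dots> = ?D X * (\<Prod>Y\<in>?Q - {X}. ?D Y)"
      using finQ X by (rule prod.remove)
    also have "\<dots> \<le> ?D X * (\<Prod>Y\<in>?Q - {X}. real l ^ l)"
      using repF by (intro mult_left_mono prod_mono conjI det_power_mat_le) auto
    also have "(\<Prod>Y\<in>?Q - {X}. real l ^ l) = real l ^ ((k - 1) * l)"
      using finQ X k by (simp add: power_mult[symmetric] mult.commute)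
    finally show ?thesis using l by (simp add: divide_le_eq)
  qed
  with k1 repF cover show thesis by (intro that[of rep s]) auto
qed

lemma L_U_rho_bounds:
  assumes k: "card (cross_sections G H E // translation_rel G H) = k"
  shows "L_norm G E < ereal (exp 1 * real l ^ (k * l))"
    "U_norm G E < real l - (real l - 1) / (2 ^ (k + 1) * real l ^ k)"
    "rho G E < ereal (exp 1 * real l ^ (k * l + 1))"
proof -
  let ?Q = "cross_sections G H E // translation_rel G H"
  define \<delta> where "\<delta> = 1 / real l ^ ((k - 1) * l)"
  \<comment> \<open>The lower bound of \<open>rayleigh_lower\<close> with \<open>L = l^2\<close> and
    \<open>r = n = l - 1\<close>.\<close>
  define \<alpha> where "\<alpha> = \<delta> * ((real l - 1) / (real l)\<^sup>2) ^ (l - 1)"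
  obtain s rep where k1: "k \<ge> 1"
    and rep: "\<forall>X\<in>?Q. rep X \<subseteq> H \<and> card (rep X) = l \<and> \<delta> \<le> (cmod (det (power_mat s (rep X))))\<^sup>2"
    and cover: "\<forall>F\<in>cross_sections G H E. \<exists>X\<in>?Q. \<exists>h\<in>H. F = h <# rep X"
    by (rule exists_good_power[OF k, folded \<delta>_def])
  obtain \<beta> where \<beta>: "0 < \<beta>" "\<beta> < (real l)\<^sup>2 - (real l - 1) / (2 ^ (k + 1) * real l ^ (k - 1))"
    and upper: "\<forall>q. 0 < q \<longrightarrow> q < (real l)\<^sup>2 \<longrightarrow>
       \<delta> \<le> q * (((real l)\<^sup>2 - q) / (real l - 1)) ^ (l - 1) \<longrightarrow> q \<le> \<beta>"
    by (rule rayleigh_upper[OF l k1, folded \<delta>_def])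
  have \<delta>0: "\<delta> > 0" unfolding \<delta>_def using l by simp
  then have \<alpha>0: "\<alpha> > 0" unfolding \<alpha>_def using l by simp
  have det_rep: "det (power_mat s (rep X)) \<noteq> 0" if "X \<in> ?Q" for X
    using rep that \<delta>0 by auto
  have energy: "\<alpha> * (\<Sum>y\<in>rep X. (cmod (f y))\<^sup>2) \<le> energy s (rep X) f \<and>
      energy s (rep X) f \<le> \<beta> * (\<Sum>y\<in>rep X. (cmod (f y))\<^sup>2)" if X: "X \<in> ?Q" for X f
  proof (cases "(\<Sum>y\<in>rep X. (cmod (f y))\<^sup>2) = 0")
    case True
    have "finite (rep X)" using bspec[OF rep X] finite_H finite_subset by blast
    then have "\<forall>y\<in>rep X. f y = 0" using True by (simp add: sum_nonneg_eq_0_iff)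
    then have "energy s (rep X) f = 0" unfolding energy_def by simp
    then show ?thesis using True by simp
  next
    case False
    then have N: "(\<Sum>y\<in>rep X. (cmod (f y))\<^sup>2) > 0"
      by (metis sum_nonneg zero_le_power2 order_le_less)
    define q where "q = energy s (rep X) f / (\<Sum>y\<in>rep X. (cmod (f y))\<^sup>2)"
    have q: "0 < q" "q < (real l)\<^sup>2" "\<delta> \<le> q * (((real l)\<^sup>2 - q) / (real l - 1)) ^ (l - 1)"
      using energy_bounds[OF _ _ det_rep[OF X] N] bspec[OF rep X] unfolding q_def by (blast, blast, meson order.trans)
    have "\<alpha> \<le> q" unfolding \<alpha>_def using q l by (intro rayleigh_lower) auto
    moreover have "q \<le> \<beta>" using upper q by blast
    ultimately show ?thesis using N unfolding q_def by (simp add: field_simps)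
  qed
  have energy': "\<alpha> * (\<Sum>y\<in>section_at g. (cmod (f y))\<^sup>2) \<le> energy s (section_at g) f \<and>
      energy s (section_at g) f \<le> \<beta> * (\<Sum>y\<in>section_at g. (cmod (f y))\<^sup>2)" if "g \<in> R" for g f
  proof -
    have "section_at g \<in> cross_sections G H E" using that R(1) unfolding cross_sections_eq by auto
    then obtain X h where X: "X \<in> ?Q" "h \<in> H" "section_at g = h <# rep X" using cover by blast
    have "rep X \<subseteq> H" using rep X by blast
    from energy_translate[OF this X(2)] energy[OF X(1)] show ?thesis unfolding X(3) by simp
  qed
  have "section_at \<one> \<in> cross_sections G H E" unfolding cross_sections_eq by simp
  then obtain X where X: "X \<in> ?Q" using cover by blast
  have F: "rep X \<subseteq> H" "card (rep X) = l" "det (power_mat s (rep X)) \<noteq> 0"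
    using bspec[OF rep X] det_rep[OF X] by auto
  note B = lift_subset card_lift[OF F]
  have L: "real d * \<alpha> \<le> L_pair E (lift s)" and U: "U_pair E (lift s) \<le> real d * \<beta>"
    using char_mat_bounds[OF F \<alpha>0 \<beta>(1)] energy' by blast+
  have dpos: "real d > 0" using d_pos by simp
  \<comment> \<open>With a positive denominator the division in the extended reals agrees with the
    real one.\<close>
  then have L0: "0 < L_pair E (lift s)" using L \<alpha>0 mult_pos_pos less_le_trans by blast
  have const: "real l / \<alpha> < exp 1 * real l ^ (k * l)"
    unfolding \<alpha>_def \<delta>_def by (rule lower_constant[OF l k1])
  have "L_norm G E \<le> L_norm_pair E (lift s)"
    unfolding L_norm_def by (rule min_over_chars_le[OF B])
  also have "\<dots> = ereal (real (card E) / L_pair E (lift s))"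
    unfolding L_norm_pair_def using L0 by simp
  also have "real (card E) / L_pair E (lift s) \<le> real (card E) / (real d * \<alpha>)"
    using L L0 dpos \<alpha>0 by (intro divide_left_mono mult_pos_pos) auto
  also have "\<dots> = real l / \<alpha>" unfolding card_E using dpos by simp
  also note const
  finally show "L_norm G E < ereal (exp 1 * real l ^ (k * l))" by simp
  have "rho G E \<le> rho_pair E (lift s)"
    unfolding rho_def by (rule min_over_chars_le[OF B])
  also have "\<dots> = ereal (U_pair E (lift s) / L_pair E (lift s))"
    unfolding rho_pair_def using L0 by simp
  also have "U_pair E (lift s) / L_pair E (lift s) \<le> (real d * \<beta>) / (real d * \<alpha>)"
    using L U dpos \<alpha>0 \<beta>(1) by (intro frac_le) auto
  also have "\<dots> = \<beta> / \<alpha>" using dpos by simp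
  \<comment> \<open>For \<open>rho\<close> the crude bound \<open>l^2\<close> on \<beta> suffices;
    it costs one factor \<open>l\<close> more than the bound on \<open>L_norm\<close>.\<close>
  also have "\<dots> \<le> (real l)\<^sup>2 / \<alpha>"
  proof -
    have "0 \<le> (real l - 1) / (2 ^ (k + 1) * real l ^ (k - 1))" using l by simp
    then show ?thesis using \<beta>(2) \<alpha>0 by (intro divide_right_mono) auto
  qed
  also have "\<dots> = real l * (real l / \<alpha>)" by (simp add: power2_eq_square)
  also have "\<dots> < real l * (exp 1 * real l ^ (k * l))"
    using const l by (intro mult_strict_left_mono) auto
  finally show "rho G E < ereal (exp 1 * real l ^ (k * l + 1))" by (simp add: mult_ac)
  have "U_norm G E \<le> U_norm_pair E (lift s)"
    unfolding U_norm_def by (rule min_over_chars_le[OF B])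
  also have "\<dots> \<le> (real d * \<beta>) / real (card E)"
    unfolding U_norm_pair_def using U by (intro divide_right_mono) auto
  also have "\<dots> = \<beta> / real l" unfolding card_E using dpos by simp
  also have "\<dots> < ((real l)\<^sup>2 - (real l - 1) / (2 ^ (k + 1) * real l ^ (k - 1))) / real l"
    using \<beta>(2) l by (intro divide_strict_right_mono) auto
  also have "\<dots> = real l - (real l - 1) / (2 ^ (k + 1) * (real l ^ (k - 1) * real l))"
    using l by (simp add: diff_divide_distrib power2_eq_square mult.assoc)
  also have "real l ^ (k - 1) * real l = real l ^ k"
    using k1 power_minus_mult[of k "real l"] by simp
  finally show "U_norm G E < real l - (real l - 1) / (2 ^ (k + 1) * real l ^ k)" .
qed

end

theorem theorem7p5:
  fixes G :: "('a, 'm) monoid_scheme" and H E :: "'a set" and l k :: nat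
  assumes "comm_group G" and "finite (carrier G)" and "subgroup H G"
    and "E \<subseteq> carrier G" and "multi_tiles G E H l" and "l > 1"
    and "card (cross_sections G H E // translation_rel G H) = k"
    and "\<exists>B. simultaneous_basis (G\<lparr>carrier := H\<rparr>) (cross_sections G H E) B"
  shows "L_norm G E < ereal (exp 1 * real l ^ (k * l)) \<and>
         U_norm G E < real l - (real l - 1) / (2 ^ (k + 1) * real l ^ k) \<and>
         rho G E < ereal (exp 1 * real l ^ (k * l + 1)) \<and>
         D_norm G E \<le> ereal (sqrt (real l))"
proof -
  interpret finite_comm_group G
    using assms(1,2) by (simp add: finite_comm_group_def finite_comm_group_axioms_def)
  obtain B where B: "simultaneous_basis (G\<lparr>carrier := H\<rparr>) (cross_sections G H E) B"
    using assms(8) by blast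
  obtain R where R: "R \<subseteq> carrier G" "\<forall>x\<in>carrier G. \<exists>g\<in>R. inv\<^bsub>G\<^esub> g \<otimes>\<^bsub>G\<^esub> x \<in> H"
    "\<forall>g\<in>R. \<forall>g'\<in>R. inv\<^bsub>G\<^esub> g \<otimes>\<^bsub>G\<^esub> g' \<in> H \<longrightarrow> g = g'"
    by (rule exists_transversal[OF assms(3)])
  \<comment> \<open>Lagrange's theorem shows that the number of right cosets can serve as
    \<open>d\<close>.\<close>
  interpret multi_tile G H E l B "card (rcosets\<^bsub>G\<^esub> H)" R
    using assms(3-6) B R lagrange[OF assms(3)] finite_comm_group_axioms
    unfolding multi_tile_def multi_tile_axioms_def by (simp add: mult.commute)
  show ?thesis using L_U_rho_bounds[OF assms(7)] D_norm_le by blast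
qed

end
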